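(* Let $G$ be a finite group containing a normal subgroup $E\cong C_2^r$, and let $K$ be a normal subgroup of $G$ of index $2^r$ containing $E$. Suppose there exists a signature set on $K$ with respect to $E$. Then $G\in\mathcal{H}$, i.e. $G$ contains a Hadamard difference set.
   Context: Functions on a finite group are identified with group ring elements via $F\leftrightarrow\sum_g F(g)g$; for $A=\sum a_g g$, $A^{(-1)}=\sum a_g g^{-1}$. A Hadamard difference set in $G$ is a subset $D$ whose $\{\pm1\}$-valued characteristic function ($-1$ on $D$, $+1$ off $D$) satisfies $DD^{(-1)}=|G|$ in $\mathbb{Z}G$; $\mathcal{H}$ is the class of groups containing one. Let $E=\langle x_1,\dots,x_r\rangle\cong C_2^r$, $U_r=\mathrm{GF}(2)^r$, and for $u\in U_r$ let $\chi_u=\prod_{i=1}^r(1+(-1)^{u_i}x_i)\in\mathbb{Z}E$ (the characters of $E$). A signature block on $K$ with respect to $\chi_u$ is an element $A_u\in\mathbb{Z}K$ that is $\{\pm1\}$-valued on some set of coset representatives for $E$ in $K$ and zero elsewhere, with $A_u\chi_uA_u^{(-1)}=\frac{|K|}{2^r}\chi_u$ in $\mathbb{Z}K$. A signature set on $K$ with respect to $E$ is a multiset $\{A_u:u\in U_r\}$ with each $A_u$ a signature block with respect to $\chi_u$. *)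

theory Defs
  imports "HOL-Algebra.Algebra" "HOL-Library.Z2"
begin

text \<open>
  An element $\sum_g F(g)\,g$ of $\mathbb{Z}G$, for a finite group $G$, is represented by its
  coefficient function, extended by $0$ outside the carrier, so equality in $\mathbb{Z}G$ is
  equality of functions.
\<close>

definition gr_elem :: "'a \<Rightarrow> 'a \<Rightarrow> int" where
  "gr_elem h = (\<lambda>g. if g = h then 1 else 0)"

definition gr_mult :: "('a, 'b) monoid_scheme \<Rightarrow> ('a \<Rightarrow> int) \<Rightarrow> ('a \<Rightarrow> int) \<Rightarrow> 'a \<Rightarrow> int" where
  "gr_mult G A B =
     (\<lambda>g. \<Sum>(a, b) \<in> {(a, b). a \<in> carrier G \<and> b \<in> carrier G \<and> a \<otimes>\<^bsub>G\<^esub> b = g}. A a * B b)"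

definition gr_inv :: "('a, 'b) monoid_scheme \<Rightarrow> ('a \<Rightarrow> int) \<Rightarrow> 'a \<Rightarrow> int" where
  "gr_inv G A = (\<lambda>g. if g \<in> carrier G then A (inv\<^bsub>G\<^esub> g) else 0)"

definition gr_scale :: "int \<Rightarrow> ('a \<Rightarrow> int) \<Rightarrow> 'a \<Rightarrow> int" where
  "gr_scale n A = (\<lambda>g. n * A g)"

definition pm_char_fun :: "('a, 'b) monoid_scheme \<Rightarrow> 'a set \<Rightarrow> 'a \<Rightarrow> int" where
  "pm_char_fun G D = (\<lambda>g. if g \<in> carrier G then (if g \<in> D then - 1 else 1) else 0)"

definition hadamard_difference_set :: "('a, 'b) monoid_scheme \<Rightarrow> 'a set \<Rightarrow> bool" where
  "hadamard_difference_set G D \<longleftrightarrow>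
     D \<subseteq> carrier G \<and>
     gr_mult G (pm_char_fun G D) (gr_inv G (pm_char_fun G D))
       = gr_scale (int (order G)) (gr_elem \<one>\<^bsub>G\<^esub>)"

definition hadamard_groups :: "('a, 'b) monoid_scheme set" where
  "hadamard_groups =
     {G. group G \<and> finite (carrier G) \<and> (\<exists>D. hadamard_difference_set G D)}"

definition C2_power :: "nat \<Rightarrow> (nat \<Rightarrow> int) monoid" where
  "C2_power r = product_group {..<r} (\<lambda>_. integer_mod_group 2)"

text \<open>
  The generators $x_1,\dots,x_r$ and the coordinates of $u \in \mathrm{GF}(2)^r$ are
  indexed by $0,\dots,r-1$.
\<close>

definition U :: "nat \<Rightarrow> (nat \<Rightarrow> bit) set" where
  "U r = {..<r} \<rightarrow>\<^sub>E UNIV"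

definition chi_factor ::
    "('a, 'b) monoid_scheme \<Rightarrow> (nat \<Rightarrow> 'a) \<Rightarrow> (nat \<Rightarrow> bit) \<Rightarrow> nat \<Rightarrow> 'a \<Rightarrow> int" where
  "chi_factor K x u i =
     (\<lambda>g. gr_elem \<one>\<^bsub>K\<^esub> g + (if u i = 0 then 1 else - 1) * gr_elem (x i) g)"

text \<open>
  The factors commute when the \<open>x i\<close> do, so the order of multiplication chosen here is immaterial.
\<close>

primrec chi ::
    "('a, 'b) monoid_scheme \<Rightarrow> (nat \<Rightarrow> 'a) \<Rightarrow> (nat \<Rightarrow> bit) \<Rightarrow> nat \<Rightarrow> 'a \<Rightarrow> int" where
  "chi K x u 0 = gr_elem \<one>\<^bsub>K\<^esub>"
| "chi K x u (Suc r) = gr_mult K (chi K x u r) (chi_factor K x u r)"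

definition coset_representatives :: "('a, 'b) monoid_scheme \<Rightarrow> 'a set \<Rightarrow> 'a set \<Rightarrow> bool" where
  "coset_representatives K E T \<longleftrightarrow>
     T \<subseteq> carrier K \<and> (\<forall>C \<in> rcosets\<^bsub>K\<^esub> E. \<exists>!t. t \<in> T \<inter> C)"

text \<open>
  \<open>E\<close> is understood to be a normal subgroup of the finite group \<open>K\<close> with
  $E = \langle x_1,\dots,x_r\rangle \cong C_2^r$. Then $2^r$ divides $|K|$, so the integer
  division below is exact, and the right cosets of \<open>E\<close> are also its left cosets.
\<close>

definition signature_block ::
    "('a, 'b) monoid_scheme \<Rightarrow> 'a set \<Rightarrow> nat \<Rightarrow> (nat \<Rightarrow> 'a) \<Rightarrow> (nat \<Rightarrow> bit) \<Rightarrow> ('a \<Rightarrow> int) \<Rightarrow> bool" where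
  "signature_block K E r x u A \<longleftrightarrow>
     (\<exists>T. coset_representatives K E T \<and> (\<forall>g \<in> T. A g \<in> {1, - 1}) \<and> (\<forall>g. g \<notin> T \<longrightarrow> A g = 0)) \<and>
     gr_mult K (gr_mult K A (chi K x u r)) (gr_inv K A)
       = gr_scale (int (order K div 2 ^ r)) (chi K x u r)"

text \<open>
  The multiset $\{A_u : u \in U_r\}$ is given as a family indexed by $U_r$; distinct indices may
  carry the same block.
\<close>

definition signature_set ::
    "('a, 'b) monoid_scheme \<Rightarrow> 'a set \<Rightarrow> nat \<Rightarrow> (nat \<Rightarrow> 'a) \<Rightarrow> ((nat \<Rightarrow> bit) \<Rightarrow> 'a \<Rightarrow> int) \<Rightarrow> bool" where
  "signature_set K E r x A \<longleftrightarrow> (\<forall>u \<in> U r. signature_block K E r x u (A u))"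

end

theory Submission imports Defs begin

text \<open>
  The difference set is $D = \sum_u g_u A_u \chi_u$ for a suitable transversal $(g_u)$ of $K$ in
  $G$. Orthogonality of the characters leaves
  $D D^{(-1)} = 2^r \sum_u g_u A_u \chi_u A_u^{(-1)} g_u^{-1} = |K| \sum_u g_u \chi_u g_u^{-1}$,
  and this is $2^r |K| = |G|$ as soon as $u \mapsto g_u \chi_u g_u^{-1}$ permutes the $2^r$
  characters, since those sum to $2^r$.

  Such a transversal exists by a theorem of Drisko: given $2n - 1$ injective functions on an
  $n$-element set, the points can be assigned distinct functions so that their images are distinct.
  The signature equation forces $K$ to fix every $\chi_u$, so the orbits of $G$ on the characters
  have 2-power size. Apply Drisko's theorem to the orbits in decreasing order of size: when an
  orbit of size $s > 1$ is treated, the number of unused cosets is a multiple of $s$ and exceeds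
  $s$, because the trivial character is still waiting; so at least $2s$ cosets are available.
\<close>

section \<open>Partial transversals of arrays, Drisko's theorem, transversals of invariant
  blocks\<close>

section \<open>Transversals\<close>

text \<open>\<open>P\<close> is read as an array with rows \<open>I\<close>, columns
  \<open>A\<close> and entries \<open>P i a\<close>. The chosen cells are indexed by their symbols,
  so distinctness of symbols is built in and only rows and columns carry an injectivity
  condition.\<close>

definition partial_transversal ::
    "('i \<Rightarrow> 'a \<Rightarrow> 'b) \<Rightarrow> 'i set \<Rightarrow> 'a set \<Rightarrow> 'b set \<Rightarrow> ('b \<Rightarrow> 'a) \<Rightarrow> ('b \<Rightarrow> 'i) \<Rightarrow> bool" where
  "partial_transversal P I A S c \<rho> \<longleftrightarrow>
     inj_on c S \<and> c ` S \<subseteq> A \<and> inj_on \<rho> S \<and> \<rho> ` S \<subseteq> I \<and> (\<forall>b\<in>S. P (\<rho> b) (c b) = b)"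

text \<open>Removing \<open>b\<close> from \<open>S\<close> in the freeness conditions covers two
  uses at once: moving an old symbol to another cell and adding a new symbol.\<close>

lemma partial_transversal_update:
  assumes "partial_transversal P I A S c \<rho>"
    and "a \<in> A - c ` (S - {b})" and "i \<in> I - \<rho> ` (S - {b})" and "P i a = b"
  shows "partial_transversal P I A (insert b S) (c(b := a)) (\<rho>(b := i))"
  using assms unfolding partial_transversal_def inj_on_def by (auto simp: image_iff)

text \<open>An augmenting-path argument: a spare row at a reachable column shows either a new
  symbol, which enlarges the transversal, or an old one, whose cell can be moved so that its column
  becomes free. The symbols of \<open>S\<close> are kept, but their cells may change.\<close>

lemma partial_transversal_augment:
  assumes pt: "partial_transversal P I A S c \<rho>"
    and fin: "finite A" "finite S" "finite I"
    and inj: "\<And>i. i \<in> I \<Longrightarrow> inj_on (P i) A"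
    and less: "card S < card A" "card S < card (I - \<rho> ` S)"
  shows "\<exists>b c' \<rho>'. b \<notin> S \<and> partial_transversal P I A (insert b S) c' \<rho>'"
proof (rule ccontr)
  assume no: "\<not> ?thesis"
  have c: "inj_on c S" "c ` S \<subseteq> A" and \<rho>: "inj_on \<rho> S"
    using pt by (auto simp: partial_transversal_def)
  txt \<open>
    A point \<open>a\<close> is reachable if an alternating path with rows from \<open>J\<close> frees it. Each further row
    adds a symbol to the set \<open>R\<close> of symbols on such paths, which cannot outgrow \<open>S\<close>.
  \<close>
  define reach where "reach J R a \<longleftrightarrow> (\<exists>c' \<rho>'. partial_transversal P I A S c' \<rho>' \<and> a \<notin> c' ` S \<and>
      (\<forall>b \<in> S - R. c' b = c b) \<and> \<rho>' ` S \<subseteq> \<rho> ` S \<union> J)" for J R a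
  have "finite J \<Longrightarrow> J \<subseteq> I - \<rho> ` S \<Longrightarrow>
      \<exists>R \<subseteq> S. card J \<le> card R \<and> (\<forall>a \<in> A - c ` (S - R). reach J R a)" for J
  proof (induction J rule: finite_induct)
    case empty
    show ?case using pt by (intro exI[of _ "{}"]) (auto simp: reach_def)
  next
    case (insert i J)
    then obtain R where R: "R \<subseteq> S" "card J \<le> card R" "\<And>a. a \<in> A - c ` (S - R) \<Longrightarrow> reach J R a"
      by auto
    have i: "i \<in> I" "i \<notin> \<rho> ` S" using insert.prems by auto
    let ?A = "A - c ` (S - R)"
    have finR: "finite R" using R(1) fin(2) finite_subset by blast
    have "card ?A = card A - card (c ` (S - R))"
      using c(2) fin by (intro card_Diff_subset) auto
    also have "card (c ` (S - R)) = card S - card R"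
      using c(1) R(1) finR by (simp add: card_image inj_on_diff card_Diff_subset)
    \<comment> \<open>As \<open>S\<close> does not fill all columns, more than \<open>card R\<close>
      columns are reachable, and the injective row \<open>i\<close> cannot send all of them into
      \<open>R\<close>.\<close>
    finally have "card R < card ?A"
      using less(1) card_mono[OF fin(2) R(1)] by linarith
    moreover have "inj_on (P i) ?A" using inj[OF i(1)] by (rule inj_on_diff)
    ultimately have "\<not> P i ` ?A \<subseteq> R"
      using finR card_inj_on_le[of "P i" ?A R] by fastforce
    then obtain a where a: "a \<in> ?A" "P i a \<notin> R" by blast
    define b where "b = P i a"
    obtain c' \<rho>' where c': "partial_transversal P I A S c' \<rho>'" "a \<notin> c' ` S"
      "\<And>b. b \<in> S - R \<Longrightarrow> c' b = c b" "\<rho>' ` S \<subseteq> \<rho> ` S \<union> J"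
      using R(3)[OF a(1)] unfolding reach_def by metis
    have upd: "partial_transversal P I A (Set.insert b S) (c'(b := a)) (\<rho>'(b := i))"
      using c' a i insert.hyps(2)
      by (intro partial_transversal_update) (auto simp: b_def)
    \<comment> \<open>A symbol outside \<open>S\<close> would give the excluded enlargement, so the
      update only moves the cell of \<open>b\<close>.\<close>
    with no have bS: "b \<in> S" by blast
    with upd have upd: "partial_transversal P I A S (c'(b := a)) (\<rho>'(b := i))"
      by (simp add: insert_absorb)
    have bR: "b \<in> S - R" using bS a(2) b_def by simp
    \<comment> \<open>Moving \<open>b\<close> vacates its column, which is still \<open>c b\<close>
      because \<open>b\<close> is not in \<open>R\<close>. This is the only column that has to
      become reachable when \<open>b\<close> joins \<open>R\<close>.\<close>
    have "reach (Set.insert i J) (Set.insert b R) (c b)"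
      unfolding reach_def
    proof (intro exI conjI)
      show "partial_transversal P I A S (c'(b := a)) (\<rho>'(b := i))" by (rule upd)
      have "inj_on c' S" using c'(1) by (simp add: partial_transversal_def)
      then have "c' b \<notin> (c'(b := a)) ` S"
        using c'(2) bS by (auto simp: inj_on_def)
      then show "c b \<notin> (c'(b := a)) ` S" using c'(3) bR by simp
      show "\<forall>b' \<in> S - Set.insert b R. (c'(b := a)) b' = c b'" using c'(3) by simp
      show "(\<rho>'(b := i)) ` S \<subseteq> \<rho> ` S \<union> Set.insert i J" using c'(4) by auto
    qed
    moreover have "reach (Set.insert i J) (Set.insert b R) a'" if "a' \<in> ?A" for a'
      using R(3)[OF that] unfolding reach_def by blast
    moreover have "a' \<in> ?A \<or> a' = c b" if "a' \<in> A - c ` (S - Set.insert b R)" for a'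
      using that by auto
    ultimately have "\<forall>a' \<in> A - c ` (S - Set.insert b R). reach (Set.insert i J) (Set.insert b R) a'"
      by blast
    moreover have "card (Set.insert i J) \<le> card (Set.insert b R)"
      using R(2) finR insert.hyps bR by simp
    ultimately show ?case using R(1) bS by (intro exI[of _ "Set.insert b R"]) auto
  qed
  from this[of "I - \<rho> ` S"] fin(3) obtain R where "R \<subseteq> S" "card (I - \<rho> ` S) \<le> card R" by auto
  then show False using less(2) card_mono[OF fin(2), of R] by linarith
qed

text \<open>Write n for \<open>card A\<close>. With t < n cells chosen, 2n - 1 rows leave at least
  2n - 1 - t > t spare ones, which is the row condition for one more augmentation.\<close>

theorem drisko_transversal:
  assumes "finite A" "finite I" and inj: "\<And>i. i \<in> I \<Longrightarrow> inj_on (P i) A"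
    and card: "2 * card A \<le> card I + 1"
  obtains \<rho> where "\<rho> ` A \<subseteq> I" "inj_on \<rho> A" "inj_on (\<lambda>a. P (\<rho> a) a) A"
proof -
  have "t \<le> card A \<Longrightarrow> \<exists>S c \<rho>. finite S \<and> card S = t \<and> partial_transversal P I A S c \<rho>" for t
  proof (induction t)
    case 0
    show ?case by (intro exI[of _ "{}"]) (simp add: partial_transversal_def)
  next
    case (Suc t)
    then obtain S c \<rho> where S: "finite S" "card S = t" "partial_transversal P I A S c \<rho>" by auto
    have "card (I - \<rho> ` S) = card I - t"
      using S assms(2) by (subst card_Diff_subset) (auto simp: partial_transversal_def card_image)
    then have "card S < card (I - \<rho> ` S)" using S(2) card Suc.prems by linarith
    moreover have "card S < card A" using S(2) Suc.prems by simp
    ultimately obtain b c' \<rho>' where "b \<notin> S" "partial_transversal P I A (insert b S) c' \<rho>'"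
      using partial_transversal_augment[OF S(3) assms(1) S(1) assms(2) inj] by blast
    then show ?case using S by (intro exI[of _ "insert b S"]) auto
  qed
  from this[OF order.refl] obtain S c \<rho> where S: "finite S" "card S = card A"
    and pt: "partial_transversal P I A S c \<rho>" by blast
  have "inj_on c S" "c ` S \<subseteq> A" using pt by (auto simp: partial_transversal_def)
  then have c: "bij_betw c S A"
    using S assms(1) card_seteq[of A "c ` S"] by (simp add: bij_betw_def card_image)
  \<comment> \<open>With \<open>card A\<close> symbols every column is used, so \<open>c\<close> is
    a bijection and its inverse turns the indexing by symbols into one by columns.\<close>
  let ?d = "the_inv_into S c"
  have d: "bij_betw ?d A S" using c by (rule bij_betw_the_inv_into)
  have cd: "c (?d a) = a" if "a \<in> A" for a
    using that c by (simp add: f_the_inv_into_f bij_betw_def)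
  have dS: "?d a \<in> S" if "a \<in> A" for a using that d by (auto simp: bij_betw_def)
  show thesis
  proof (rule that[of "\<rho> \<circ> ?d"])
    show "(\<rho> \<circ> ?d) ` A \<subseteq> I" using pt dS by (auto simp: partial_transversal_def)
    show "inj_on (\<rho> \<circ> ?d) A"
      using pt d by (intro comp_inj_on) (auto simp: partial_transversal_def bij_betw_def)
    have "P ((\<rho> \<circ> ?d) a) a = ?d a" if "a \<in> A" for a
      using pt dS[OF that] cd[OF that] by (auto simp: partial_transversal_def)
    then show "inj_on (\<lambda>a. P ((\<rho> \<circ> ?d) a) a) A"
      using d by (auto simp: bij_betw_def inj_on_def)
  qed
qed

text \<open>Induction on the number of blocks, removing a largest block together with the rows it
  uses. Among powers of 2 every smaller size divides the largest one, so the divisibility hypothesis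
  survives for the remaining rows.\<close>

theorem transversal_of_blocks:
  assumes "finite Q" "disjoint Q" "\<And>B. B \<in> Q \<Longrightarrow> finite B"
    and "finite I" "card I = card (\<Union>Q)"
    and "\<And>B. B \<in> Q \<Longrightarrow> \<exists>k. card B = 2 ^ k" "\<And>B. B \<in> Q \<Longrightarrow> card B dvd card I"
    and "Q \<noteq> {} \<Longrightarrow> \<exists>B\<in>Q. card B = 1"
    and inj: "\<And>i B. i \<in> I \<Longrightarrow> B \<in> Q \<Longrightarrow> inj_on (P i) B"
    and inv: "\<And>i B. i \<in> I \<Longrightarrow> B \<in> Q \<Longrightarrow> P i ` B \<subseteq> B"
  shows "\<exists>\<rho>. \<rho> ` (\<Union>Q) \<subseteq> I \<and> inj_on \<rho> (\<Union>Q) \<and> inj_on (\<lambda>a. P (\<rho> a) a) (\<Union>Q)"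
  using assms
proof (induction "card Q" arbitrary: Q I)
  case 0
  then show ?case by auto
next
  case (Suc n)
  note fin = Suc.prems(1,3,4) and disj = Suc.prems(2) and cI = Suc.prems(5)
    and pow = Suc.prems(6) and dv = Suc.prems(7)
  have "Q \<noteq> {}" using Suc.hyps(2) by auto
  then obtain B0 where B0: "B0 \<in> Q" "card B0 = 1" using Suc.prems(8) by blast
  have "Max (card ` Q) \<in> card ` Q" using fin(1) \<open>Q \<noteq> {}\<close> by (intro Max_in) auto
  then obtain B where B: "B \<in> Q" and "card B = Max (card ` Q)" by auto
  then have max: "card B' \<le> card B" if "B' \<in> Q" for B'
    using that fin(1) by simp
  have dvd: "card B' dvd card B" if "B' \<in> Q" for B'
  proof -
    from pow[OF B] pow[OF that] obtain k l where "card B = 2 ^ k" "card B' = 2 ^ l" by auto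
    with max[OF that] show ?thesis by (simp add: le_imp_power_dvd)
  qed
  let ?Q = "Q - {B}"
  have U: "\<Union>Q = B \<union> \<Union>?Q" using B by auto
  have dis: "B \<inter> \<Union>?Q = {}" using disj B by (auto simp: disjoint_def)
  have cU: "card (\<Union>Q) = card B + card (\<Union>?Q)"
    unfolding U using fin B dis by (intro card_Un_disjoint) auto
  have rest: "B0 \<in> ?Q" if "card B \<noteq> 1" using that B0 by auto
  \<comment> \<open>The \<open>+ 1\<close> matters for singletons: the last block may have a single
    row left.\<close>
  have enough: "2 * card B \<le> card I + 1"
  proof (cases "card B = 1")
    case True
    then show ?thesis using cU cI by simp
  next
    case False
    have "card B0 \<le> card (\<Union>?Q)"
      using rest[OF False] fin by (intro card_mono) auto
    with B0(2) have "card (\<Union>?Q) \<noteq> 0" by simp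
    with cU cI have "card B < card I" by simp
    moreover obtain m where m: "card I = card B * m" using dv[OF B] by blast
    ultimately have "2 \<le> m" by (cases m) (auto simp: Suc_le_eq)
    then have "2 * card B \<le> m * card B" by (rule mult_le_mono1)
    also have "m * card B = card I" using m by (simp add: mult.commute)
    finally show ?thesis by simp
  qed
  obtain \<rho>1 where \<rho>1: "\<rho>1 ` B \<subseteq> I" "inj_on \<rho>1 B" "inj_on (\<lambda>a. P (\<rho>1 a) a) B"
    using drisko_transversal[of B I P] fin B Suc.prems(9) enough by blast
  let ?I = "I - \<rho>1 ` B"
  have cI': "card ?I = card I - card B"
    using \<rho>1 fin B by (simp add: card_Diff_subset card_image)
  have "\<exists>\<rho>. \<rho> ` (\<Union>?Q) \<subseteq> ?I \<and> inj_on \<rho> (\<Union>?Q) \<and> inj_on (\<lambda>a. P (\<rho> a) a) (\<Union>?Q)"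
  proof (rule Suc.hyps(1))
    show "n = card ?Q" using Suc.hyps(2) B fin by simp
    show "disjoint ?Q" using disj by (auto simp: disjoint_def)
    show "card ?I = card (\<Union>?Q)" using cI' cI cU by simp
    show "card B' dvd card ?I" if "B' \<in> ?Q" for B'
      unfolding cI' using that dv dvd by (intro dvd_diff_nat) auto
    \<comment> \<open>If the removed largest block is a singleton, so are all the others; if it is
      not, \<open>B0\<close> remains.\<close>
    show "\<exists>B\<in>?Q. card B = 1" if "?Q \<noteq> {}"
    proof (cases "card B = 1")
      case True
      from that obtain B' where B': "B' \<in> ?Q" by blast
      with dvd[of B'] True have "card B' = 1" by simp
      with B' show ?thesis by blast
    next
      case False
      with rest B0 show ?thesis by blast
    qed
  qed (use Suc.prems in auto)
  then obtain \<rho>2 where \<rho>2: "\<rho>2 ` (\<Union>?Q) \<subseteq> ?I" "inj_on \<rho>2 (\<Union>?Q)"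
    "inj_on (\<lambda>a. P (\<rho>2 a) a) (\<Union>?Q)" by blast
  define W where "W = \<Union>?Q"
  define \<rho> where "\<rho> a = (if a \<in> B then \<rho>1 a else \<rho>2 a)" for a
  have on_B: "\<rho> a = \<rho>1 a" if "a \<in> B" for a using that by (simp add: \<rho>_def)
  have on_W: "\<rho> a = \<rho>2 a" if "a \<in> W" for a using that dis by (auto simp: \<rho>_def W_def)
  have inj: "inj_on \<rho> B" "inj_on \<rho> W"
    "inj_on (\<lambda>a. P (\<rho> a) a) B" "inj_on (\<lambda>a. P (\<rho> a) a) W"
    using \<rho>1 \<rho>2 unfolding W_def[symmetric] by (simp_all add: inj_on_def on_B on_W)
  have img: "\<rho> ` B = \<rho>1 ` B" "\<rho> ` W \<subseteq> ?I"
    using \<rho>2(1) unfolding W_def[symmetric] by (auto simp: on_B on_W)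
  \<comment> \<open>Every row preserves every block, so the values on \<open>B\<close> and on
    \<open>W\<close> stay apart and the two injective pieces can be glued.\<close>
  have "P (\<rho> a) a \<in> B" if "a \<in> B" for a
    using that Suc.prems(10)[of "\<rho> a" B] \<rho>1(1) B on_B[OF that] by auto
  then have imB: "(\<lambda>a. P (\<rho> a) a) ` B \<subseteq> B" by auto
  have "P (\<rho> a) a \<in> W" if a: "a \<in> W" for a
  proof -
    obtain B' where "B' \<in> ?Q" "a \<in> B'" using a by (auto simp: W_def)
    moreover have "\<rho> a \<in> I" using a img(2) by auto
    ultimately show ?thesis using Suc.prems(10)[of "\<rho> a" B'] by (auto simp: W_def)
  qed
  then have imW: "(\<lambda>a. P (\<rho> a) a) ` W \<subseteq> W" by auto
  have "inj_on \<rho> (B \<union> W)"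
    unfolding inj_on_Un using inj(1,2) img by blast
  moreover have "inj_on (\<lambda>a. P (\<rho> a) a) (B \<union> W)"
    unfolding inj_on_Un using inj(3,4) imB imW dis[folded W_def] by blast
  moreover have "\<rho> ` (B \<union> W) \<subseteq> I" using img \<rho>1(1) by blast
  ultimately show ?case unfolding U W_def[symmetric] by blast
qed

section \<open>Convolution, inversion and the products chi_u in the group ring\<close>

section \<open>Group rings\<close>

text \<open>For a subgroup \<open>H\<close> this is the subring ZH of ZG. The function type alone
  does not force coefficients outside to vanish.\<close>

definition gr_on :: "'a set \<Rightarrow> ('a \<Rightarrow> int) set" where
  "gr_on S = {A. \<forall>g. g \<notin> S \<longrightarrow> A g = 0}"

lemma gr_onD: "A \<in> gr_on S \<Longrightarrow> g \<notin> S \<Longrightarrow> A g = 0"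
  by (simp add: gr_on_def)

lemma gr_on_mono: "A \<in> gr_on S \<Longrightarrow> S \<subseteq> T \<Longrightarrow> A \<in> gr_on T"
  by (auto simp: gr_on_def)

lemma gr_elem_on: "h \<in> S \<Longrightarrow> gr_elem h \<in> gr_on S"
  by (auto simp: gr_elem_def gr_on_def)

locale finite_group = group G for G (structure) +
  assumes finite_carrier [simp]: "finite (carrier G)"
begin

abbreviation gmult :: "('a \<Rightarrow> int) \<Rightarrow> ('a \<Rightarrow> int) \<Rightarrow> 'a \<Rightarrow> int" (infixl "\<star>" 70) where
  "A \<star> B \<equiv> gr_mult G A B"

lemma gr_mult_eq:
  "(A \<star> B) g = (if g \<in> carrier G then \<Sum>a\<in>carrier G. A a * B (inv a \<otimes> g) else 0)"
proof (cases "g \<in> carrier G")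
  case True
  have "(A \<star> B) g = (\<Sum>a\<in>carrier G. A a * B (inv a \<otimes> g))"
    unfolding gr_mult_def
    by (rule sum.reindex_bij_witness[of _ "\<lambda>a. (a, inv a \<otimes> g)" fst])
       (use True in \<open>auto simp: m_assoc[symmetric]\<close>)
  with True show ?thesis by simp
next
  case False
  then have "{(a, b). a \<in> carrier G \<and> b \<in> carrier G \<and> a \<otimes> b = g} = {}" by auto
  with False show ?thesis by (simp only: gr_mult_def sum.empty if_False)
qed

lemma gr_mult_on: "A \<star> B \<in> gr_on (carrier G)"
  by (simp add: gr_on_def gr_mult_eq)

lemma inv_mult_mem_iff:
  assumes "subgroup H G" "a \<in> H" "g \<in> carrier G"
  shows "inv a \<otimes> g \<in> H \<longleftrightarrow> g \<in> H"
proof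
  have a: "a \<in> carrier G" using assms by (simp add: subgroup.mem_carrier)
  assume "inv a \<otimes> g \<in> H"
  then have "a \<otimes> (inv a \<otimes> g) \<in> H" using assms subgroup.m_closed by metis
  then show "g \<in> H" using a assms by (simp add: m_assoc[symmetric])
qed (use assms in \<open>auto intro: subgroup.m_closed subgroup.m_inv_closed\<close>)

lemma gr_mult_on_subgroup:
  assumes "subgroup H G" "A \<in> gr_on H" "B \<in> gr_on H"
  shows "A \<star> B \<in> gr_on H"
  unfolding gr_on_def
proof (intro CollectI allI impI)
  fix g assume g: "g \<notin> H"
  have "A a * B (inv a \<otimes> g) = 0" if "g \<in> carrier G" for a
    using that g assms inv_mult_mem_iff[of H a g] by (cases "a \<in> H") (auto simp: gr_onD)
  then show "(A \<star> B) g = 0" by (simp only: gr_mult_eq sum.neutral_const cong: if_cong sum.cong) simp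
qed

lemma inv_cancel:
  assumes "a \<in> carrier G" "b \<in> carrier G"
  shows "b \<otimes> a \<otimes> inv a = b" "b \<otimes> inv a \<otimes> a = b"
  using assms by (simp_all add: m_assoc)

lemma gr_mult_assoc: "A \<star> B \<star> C = A \<star> (B \<star> C)"
proof
  fix g
  show "(A \<star> B \<star> C) g = (A \<star> (B \<star> C)) g"
  proof (cases "g \<in> carrier G")
    case True
    have "(A \<star> B \<star> C) g =
        (\<Sum>b\<in>carrier G. \<Sum>a\<in>carrier G. A a * B (inv a \<otimes> b) * C (inv b \<otimes> g))"
      using True by (simp add: gr_mult_eq sum_distrib_right)
    also have "\<dots> = (\<Sum>a\<in>carrier G. \<Sum>b\<in>carrier G. A a * B (inv a \<otimes> b) * C (inv b \<otimes> g))"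
      by (rule sum.swap)
    also have "\<dots> = (\<Sum>a\<in>carrier G. \<Sum>b\<in>carrier G. A a * (B b * C (inv b \<otimes> (inv a \<otimes> g))))"
    proof (rule sum.cong[OF refl])
      fix a assume a: "a \<in> carrier G"
      show "(\<Sum>b\<in>carrier G. A a * B (inv a \<otimes> b) * C (inv b \<otimes> g)) =
          (\<Sum>b\<in>carrier G. A a * (B b * C (inv b \<otimes> (inv a \<otimes> g))))"
        by (rule sum.reindex_bij_witness[of _ "\<lambda>b. a \<otimes> b" "\<lambda>b. inv a \<otimes> b"])
           (use a True in \<open>auto simp: m_assoc[symmetric] inv_mult_group inv_cancel\<close>)
    qed
    also have "\<dots> = (A \<star> (B \<star> C)) g"
      using True by (simp add: gr_mult_eq sum_distrib_left)
    finally show ?thesis .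
  qed (simp add: gr_mult_eq)
qed

lemma gr_mult_sum_left: "(\<lambda>g. \<Sum>i\<in>I. F i g) \<star> B = (\<lambda>g. \<Sum>i\<in>I. (F i \<star> B) g)"
proof
  fix g
  show "((\<lambda>g. \<Sum>i\<in>I. F i g) \<star> B) g = (\<Sum>i\<in>I. (F i \<star> B) g)"
    using sum.swap[of "\<lambda>a i. F i a * B (inv a \<otimes> g)" I "carrier G"]
    by (simp add: gr_mult_eq sum_distrib_right)
qed

lemma gr_mult_sum_right: "A \<star> (\<lambda>g. \<Sum>i\<in>I. F i g) = (\<lambda>g. \<Sum>i\<in>I. (A \<star> F i) g)"
proof
  fix g
  show "(A \<star> (\<lambda>g. \<Sum>i\<in>I. F i g)) g = (\<Sum>i\<in>I. (A \<star> F i) g)"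
    using sum.swap[of "\<lambda>a i. A a * F i (inv a \<otimes> g)" I "carrier G"]
    by (simp add: gr_mult_eq sum_distrib_left)
qed

lemma gr_mult_scale_left: "gr_scale n A \<star> B = gr_scale n (A \<star> B)"
  by (rule ext) (simp add: gr_mult_eq gr_scale_def sum_distrib_left mult.assoc)

lemma gr_mult_scale_right: "A \<star> gr_scale n B = gr_scale n (A \<star> B)"
  by (rule ext) (simp add: gr_mult_eq gr_scale_def sum_distrib_left mult.left_commute)

lemma gr_mult_zero_left: "(\<lambda>_. 0) \<star> B = (\<lambda>_. 0)"
  and gr_mult_zero_right: "A \<star> (\<lambda>_. 0) = (\<lambda>_. 0)"
  by (rule ext, simp add: gr_mult_eq)+

lemma gr_elem_mult_apply:
  assumes "a \<in> carrier G" "g \<in> carrier G"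
  shows "(gr_elem a \<star> A) g = A (inv a \<otimes> g)"
proof -
  have "(gr_elem a \<star> A) g = (\<Sum>b\<in>carrier G. if b = a then A (inv b \<otimes> g) else 0)"
    unfolding gr_mult_eq if_P[OF assms(2)] by (rule sum.cong) (auto simp: gr_elem_def)
  then show ?thesis using assms by simp
qed

lemma mult_gr_elem_apply:
  assumes "a \<in> carrier G" "g \<in> carrier G"
  shows "(A \<star> gr_elem a) g = A (g \<otimes> inv a)"
proof -
  have "inv b \<otimes> g = a \<longleftrightarrow> b = g \<otimes> inv a" if "b \<in> carrier G" for b
    using assms that by (metis inv_solve_left inv_solve_right')
  then have "(A \<star> gr_elem a) g = (\<Sum>b\<in>carrier G. if b = g \<otimes> inv a then A b else 0)"
    unfolding gr_mult_eq if_P[OF assms(2)] by (intro sum.cong refl) (simp add: gr_elem_def)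
  then show ?thesis using assms by simp
qed

lemma gr_elem_mult_gr_elem:
  assumes "a \<in> carrier G" "b \<in> carrier G"
  shows "gr_elem a \<star> gr_elem b = gr_elem (a \<otimes> b)"
proof
  fix g
  show "(gr_elem a \<star> gr_elem b) g = gr_elem (a \<otimes> b) g"
  proof (cases "g \<in> carrier G")
    case True
    then have "inv a \<otimes> g = b \<longleftrightarrow> g = a \<otimes> b"
      using assms by (metis inv_solve_left' )
    then show ?thesis using True assms by (simp add: gr_elem_mult_apply) (simp add: gr_elem_def)
  next
    case False
    then show ?thesis using assms gr_onD[OF gr_mult_on] by (auto simp: gr_elem_def)
  qed
qed

lemma gr_inv_mult: "gr_inv G (A \<star> B) = gr_inv G B \<star> gr_inv G A"
proof
  fix g
  show "gr_inv G (A \<star> B) g = (gr_inv G B \<star> gr_inv G A) g"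
  proof (cases "g \<in> carrier G")
    case True
    have "(\<Sum>a\<in>carrier G. A a * B (inv a \<otimes> inv g)) =
        (\<Sum>b\<in>carrier G. B (inv b) * A (inv (inv b \<otimes> g)))"
      by (rule sum.reindex_bij_witness[of _ "\<lambda>b. inv g \<otimes> b" "\<lambda>a. g \<otimes> a"])
         (use True in \<open>auto simp: m_assoc[symmetric] inv_mult_group\<close>)
    with True show ?thesis by (simp add: gr_mult_eq gr_inv_def)
  qed (simp add: gr_mult_eq gr_inv_def)
qed

lemma gr_inv_sum: "gr_inv G (\<lambda>g. \<Sum>i\<in>I. F i g) = (\<lambda>g. \<Sum>i\<in>I. gr_inv G (F i) g)"
  by (auto simp: gr_inv_def)

lemma gr_inv_elem: "a \<in> carrier G \<Longrightarrow> gr_inv G (gr_elem a) = gr_elem (inv a)"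
  by (auto simp: gr_inv_def gr_elem_def fun_eq_iff)

text \<open>The signature hypotheses are stated in ZK, while the difference set is computed in ZG.
  For factors supported on \<open>H\<close> the additional pairs contribute 0, which makes the
  passage possible.\<close>

lemma gr_mult_restrict:
  assumes "subgroup H G" "A \<in> gr_on H" "B \<in> gr_on H"
  shows "gr_mult (G\<lparr>carrier := H\<rparr>) A B = A \<star> B"
proof
  fix g
  have "H \<subseteq> carrier G" by (rule subgroup.subset[OF assms(1)])
  moreover have "finite {(a, b). a \<in> carrier G \<and> b \<in> carrier G \<and> a \<otimes> b = g}"
    by (rule finite_subset[of _ "carrier G \<times> carrier G"]) auto
  ultimately show "gr_mult (G\<lparr>carrier := H\<rparr>) A B g = (A \<star> B) g"
    unfolding gr_mult_def
    by (intro sum.mono_neutral_left) (use assms in \<open>auto simp: gr_onD\<close>)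
qed

lemma gr_inv_restrict:
  assumes "subgroup H G" "A \<in> gr_on H"
  shows "gr_inv (G\<lparr>carrier := H\<rparr>) A = gr_inv G A"
proof
  fix g
  have "inv g \<notin> H" if "g \<in> carrier G" "g \<notin> H"
    using that subgroup.m_inv_closed[OF assms(1), of "inv g"] by auto
  then show "gr_inv (G\<lparr>carrier := H\<rparr>) A g = gr_inv G A g"
    using assms subgroup.mem_carrier[OF assms(1)]
    by (auto simp: gr_inv_def m_inv_consistent gr_onD)
qed

lemma chi_factor_restrict:
  "chi_factor (G\<lparr>carrier := H\<rparr>) x u i = chi_factor G x u i"
  by (simp add: chi_factor_def)

lemma chi_factor_on:
  "subgroup H G \<Longrightarrow> x i \<in> H \<Longrightarrow> chi_factor G x u i \<in> gr_on H"
  using subgroup.one_closed by (fastforce simp: chi_factor_def gr_on_def gr_elem_def)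

lemma chi_on:
  "subgroup H G \<Longrightarrow> x \<in> {..<r} \<rightarrow> H \<Longrightarrow> chi G x u r \<in> gr_on H"
proof (induction r)
  case 0
  then show ?case by (simp add: gr_elem_on subgroup.one_closed)
next
  case (Suc r)
  then show ?case
    using gr_mult_on_subgroup chi_factor_on by (auto simp: Pi_iff lessThan_Suc)
qed

lemma chi_restrict:
  "subgroup H G \<Longrightarrow> x \<in> {..<r} \<rightarrow> H \<Longrightarrow> chi (G\<lparr>carrier := H\<rparr>) x u r = chi G x u r"
proof (induction r)
  case (Suc r)
  then show ?case
    using gr_mult_restrict[OF Suc.prems(1) chi_on[of H x r u] chi_factor_on[of H x r u]]
    by (auto simp: Pi_iff lessThan_Suc chi_factor_restrict)
qed simp

lemma chi_Suc_apply:
  assumes "x \<in> {..<Suc r} \<rightarrow> carrier G" "g \<in> carrier G"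
  shows "chi G x u (Suc r) g =
    chi G x u r g + (if u r = 0 then 1 else - 1) * chi G x u r (g \<otimes> inv (x r))"
proof -
  \<comment> \<open>The factor is written as a sum over two indices so that
    \<open>gr_mult_sum_right\<close> supplies distributivity.\<close>
  have "chi_factor G x u r = (\<lambda>g. \<Sum>i\<in>{False, True}.
      (if i then gr_elem \<one> else gr_scale (if u r = 0 then 1 else - 1) (gr_elem (x r))) g)"
    by (auto simp: chi_factor_def gr_scale_def)
  then have "chi G x u (Suc r) = (\<lambda>g. \<Sum>i\<in>{False, True}. (chi G x u r \<star>
      (if i then gr_elem \<one> else gr_scale (if u r = 0 then 1 else - 1) (gr_elem (x r)))) g)"
    by (simp only: chi.simps gr_mult_sum_right)
  then show ?thesis
    using assms by (simp add: gr_mult_scale_right mult_gr_elem_apply Pi_iff)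
      (simp add: gr_scale_def mult_gr_elem_apply)
qed

lemma chi_cong: "(\<And>i. i < r \<Longrightarrow> u i = v i) \<Longrightarrow> chi G x u r = chi G x v r"
  by (induction r) (simp_all add: chi_factor_def)

text \<open>Tuples that differ only in the last coordinate contribute (1 + x_r) + (1 - x_r) = 2
  times the shorter product, so each generator doubles the sum.\<close>

lemma sum_chi:
  assumes "x \<in> {..<r} \<rightarrow> carrier G"
  shows "(\<lambda>g. \<Sum>u\<in>U r. chi G x u r g) = gr_scale (2 ^ r) (gr_elem \<one>)"
  using assms
proof (induction r)
  case 0
  show ?case by (simp add: U_def gr_scale_def)
next
  case (Suc r)
  let ?V = "(UNIV :: bit set) \<times> U r"
  have UNIV_bit: "(UNIV :: bit set) = {0, 1}" by (auto intro: bit.exhaust)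
  have U: "U (Suc r) = (\<lambda>(y, u). u(r := y)) ` ?V"
    by (simp add: U_def lessThan_Suc PiE_insert_eq)
  have inj: "inj_on (\<lambda>(y, u). u(r := y)) ?V"
    unfolding U_def by (rule inj_combinator) simp
  have IH: "(\<Sum>u\<in>U r. chi G x u r g) = gr_scale (2 ^ r) (gr_elem \<one>) g" for g
    using fun_cong[OF Suc.IH, of g] Suc.prems by (auto simp: Pi_iff)
  show ?case
  proof
    fix g
    show "(\<Sum>u\<in>U (Suc r). chi G x u (Suc r) g) = gr_scale (2 ^ Suc r) (gr_elem \<one>) g"
    proof (cases "g \<in> carrier G")
      case True
      have c: "chi G x (u(r := y)) r = chi G x u r" for u and y :: bit
        by (rule chi_cong) simp
      have "(\<Sum>u\<in>U (Suc r). chi G x u (Suc r) g) =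
          (\<Sum>y\<in>UNIV. \<Sum>u\<in>U r. chi G x (u(r := y)) (Suc r) g)"
        unfolding U sum.reindex[OF inj] by (simp add: sum.cartesian_product case_prod_beta' o_def)
      also have "\<dots> = (\<Sum>y\<in>(UNIV::bit set). \<Sum>u\<in>U r. chi G x u r g +
          (if y = 0 then 1 else - 1) * chi G x u r (g \<otimes> inv (x r)))"
        unfolding chi_Suc_apply[OF Suc.prems True] c by simp
      also have "\<dots> = 2 * (\<Sum>u\<in>U r. chi G x u r g)"
        by (simp add: UNIV_bit sum.distrib sum_negf flip: sum_distrib_left)
      also have "\<dots> = gr_scale (2 ^ Suc r) (gr_elem \<one>) g"
        unfolding IH by (simp add: gr_scale_def)
      finally show ?thesis .
    next
      case False
      then have "chi G x u (Suc r) g = 0" for u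
        using gr_onD[OF gr_mult_on] by simp
      with False show ?thesis by (auto simp: gr_scale_def gr_elem_def)
    qed
  qed
qed

end

section \<open>Conjugation, sign characters of \<open>E\<close> and their orthogonality\<close>

section \<open>Characters of an elementary abelian 2-subgroup\<close>

context finite_group begin

text \<open>The coordinate-free counterpart of the family chi_u: conjugation acts directly on these
  functions, whereas its effect on the index u depends on the generators.\<close>

definition pm_characters :: "'a set \<Rightarrow> ('a \<Rightarrow> int) set" where
  "pm_characters E = {\<psi> \<in> gr_on E. (\<forall>a\<in>E. \<psi> a \<in> {1, - 1}) \<and>
     (\<forall>a\<in>E. \<forall>b\<in>E. \<psi> (a \<otimes> b) = \<psi> a * \<psi> b)}"

definition gr_conj :: "'a \<Rightarrow> ('a \<Rightarrow> int) \<Rightarrow> 'a \<Rightarrow> int" where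
  "gr_conj g A = gr_elem g \<star> A \<star> gr_elem (inv g)"

lemma gr_conj_apply:
  assumes "g \<in> carrier G" "e \<in> carrier G"
  shows "gr_conj g A e = A (inv g \<otimes> e \<otimes> g)"
  using assms by (simp add: gr_conj_def mult_gr_elem_apply gr_elem_mult_apply m_assoc)

lemma gr_conj_mult:
  assumes "g \<in> carrier G" "h \<in> carrier G"
  shows "gr_conj (g \<otimes> h) A = gr_conj g (gr_conj h A)"
proof -
  have "gr_conj (g \<otimes> h) A = gr_elem g \<star> gr_elem h \<star> A \<star> (gr_elem (inv h) \<star> gr_elem (inv g))"
    using assms by (simp add: gr_conj_def gr_elem_mult_gr_elem inv_mult_group)
  then show ?thesis by (simp add: gr_conj_def gr_mult_assoc)
qed

text \<open>Conjugation clears all coefficients off the carrier, hence the support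
  hypothesis.\<close>

lemma gr_conj_one:
  assumes "A \<in> gr_on (carrier G)"
  shows "gr_conj \<one> A = A"
proof
  fix g
  show "gr_conj \<one> A g = A g"
    using gr_conj_apply[of \<one> g A] gr_onD[OF assms, of g] gr_onD[OF gr_mult_on, of g]
    by (cases "g \<in> carrier G") (simp_all add: gr_conj_def)
qed

lemma conj_mem_iff:
  assumes "E \<lhd> G" "g \<in> carrier G" "e \<in> carrier G"
  shows "inv g \<otimes> e \<otimes> g \<in> E \<longleftrightarrow> e \<in> E"
proof
  assume "inv g \<otimes> e \<otimes> g \<in> E"
  then have "g \<otimes> (inv g \<otimes> e \<otimes> g) \<otimes> inv g \<in> E"
    using normal.inv_op_closed2 assms by metis
  then show "e \<in> E" using assms by (simp add: m_assoc[symmetric] inv_cancel)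
qed (use normal.inv_op_closed1 assms in metis)

lemma gr_conj_characters:
  assumes "E \<lhd> G" "g \<in> carrier G" "\<psi> \<in> pm_characters E"
  shows "gr_conj g \<psi> \<in> pm_characters E"
proof -
  have E: "E \<subseteq> carrier G" using assms(1) normal_imp_subgroup subgroup.subset by blast
  have conj: "inv g \<otimes> e \<otimes> g \<in> E" if "e \<in> E" for e
    using conj_mem_iff[OF assms(1,2)] that E by auto
  have "inv g \<otimes> (a \<otimes> b) \<otimes> g = (inv g \<otimes> a \<otimes> g) \<otimes> (inv g \<otimes> b \<otimes> g)" if "a \<in> E" "b \<in> E" for a b
  proof -
    have "a \<in> carrier G" "b \<in> carrier G" using that E by auto
    then show ?thesis using assms(2) by (simp add: m_assoc[symmetric] inv_cancel)
  qed
  moreover have "a \<otimes> b \<in> carrier G" if "a \<in> E" "b \<in> E" for a b using that E by auto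
  ultimately have "gr_conj g \<psi> (a \<otimes> b) = gr_conj g \<psi> a * gr_conj g \<psi> b" if "a \<in> E" "b \<in> E" for a b
    using that E assms conj by (auto simp: gr_conj_apply subset_iff pm_characters_def)
  moreover have "gr_conj g \<psi> a \<in> {1, - 1}" if "a \<in> E" for a
  proof -
    have "a \<in> carrier G" using that E by auto
    then show ?thesis
      using assms(2,3) conj[OF that] by (simp add: gr_conj_apply pm_characters_def)
  qed
  moreover have "gr_conj g \<psi> \<in> gr_on E"
  proof -
    have "gr_conj g \<psi> e = 0" if "e \<notin> E" for e
    proof (cases "e \<in> carrier G")
      case True
      then show ?thesis using that assms conj_mem_iff[OF assms(1,2), of e]
        by (simp add: gr_conj_apply pm_characters_def gr_onD[of _ E])
    next
      case False
      then show ?thesis unfolding gr_conj_def by (rule gr_onD[OF gr_mult_on])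
    qed
    then show ?thesis by (simp add: gr_on_def)
  qed
  ultimately show ?thesis by (auto simp: pm_characters_def)
qed

end

text \<open>With exponent 2 and order 2^r, the r generators form a basis. Their independence is not
  stated separately; the order brings it in through \<open>chi_one\<close>.\<close>

locale elementary_abelian_subgroup = finite_group +
  fixes E :: "'a set" and r :: nat and x :: "nat \<Rightarrow> 'a"
  assumes subgroup_E: "subgroup E G"
    and square_E: "\<And>a. a \<in> E \<Longrightarrow> a \<otimes> a = \<one>"
    and card_E: "card E = 2 ^ r"
    and x_in: "x \<in> {..<r} \<rightarrow> E"
    and generate_x: "generate G (x ` {..<r}) = E"
begin

lemma E_carrier [simp]: "a \<in> E \<Longrightarrow> a \<in> carrier G"
  using subgroup_E by (rule subgroup.mem_carrier)

lemma E_mult [simp]: "a \<in> E \<Longrightarrow> b \<in> E \<Longrightarrow> a \<otimes> b \<in> E"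
  using subgroup_E by (rule subgroup.m_closed)

lemma E_one [simp]: "\<one> \<in> E"
  using subgroup_E by (rule subgroup.one_closed)

lemma E_inv [simp]: "a \<in> E \<Longrightarrow> inv a = a"
  using square_E by (simp add: inv_equality)

lemma finite_E [simp]: "finite E"
  using subgroup.subset[OF subgroup_E] finite_carrier by (rule finite_subset)

lemma E_comm: "a \<in> E \<Longrightarrow> b \<in> E \<Longrightarrow> a \<otimes> b = b \<otimes> a"
  using E_inv[of "a \<otimes> b"] inv_mult_group[of a b] by simp

lemma x_E [simp]: "i < r \<Longrightarrow> x i \<in> E"
  using x_in by auto

lemma chi_in_E: "chi G x u r \<in> gr_on E"
  using subgroup_E x_in by (rule chi_on)

lemma chi_Suc_E:
  assumes "j < r" "g \<in> E"
  shows "chi G x u (Suc j) g = chi G x u j g + (if u j = 0 then 1 else - 1) * chi G x u j (g \<otimes> x j)"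
  using chi_Suc_apply[of x j g u] assms by simp

text \<open>For a sign s, x_i^2 = 1 gives (1 + s x_i) x_i = s (1 + s x_i); commutativity moves x_i
  past the later factors.\<close>

lemma chi_mult_generator:
  "j \<le> r \<Longrightarrow> i < j \<Longrightarrow> g \<in> E \<Longrightarrow>
    chi G x u j (g \<otimes> x i) = (if u i = 0 then 1 else - 1) * chi G x u j g"
proof (induction j arbitrary: g)
  case (Suc j)
  have xj: "x j \<in> E" using Suc.prems by simp
  show ?case
  proof (cases "i = j")
    case True
    have "g \<otimes> x j \<otimes> x j = g" using Suc.prems xj by (simp add: m_assoc square_E)
    then show ?thesis using True Suc.prems xj by (simp add: chi_Suc_E del: chi.simps)
  next
    case False
    then have ij: "i < j" and xi: "x i \<in> E" using Suc.prems by auto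
    have "g \<otimes> x i \<otimes> x j = g \<otimes> x j \<otimes> x i"
      using Suc.prems xj xi by (simp add: m_assoc E_comm[of "x i"])
    then show ?thesis
      using Suc.IH[OF _ ij, of g] Suc.IH[OF _ ij, of "g \<otimes> x j"] Suc.prems xj xi
      by (simp add: chi_Suc_E algebra_simps del: chi.simps)
  qed
qed simp

text \<open>The sign is left unnamed: it can be identified with chi_u(e) only after chi_u(1) = 1,
  and the proof of \<open>chi_one\<close> relies on this lemma.\<close>

lemma chi_mult_E:
  assumes "e \<in> E"
  shows "\<exists>s\<in>{1, - 1}. \<forall>g\<in>E. chi G x u r (g \<otimes> e) = s * chi G x u r g"
proof -
  have "e \<in> generate G (x ` {..<r})" using assms generate_x by simp
  then show ?thesis
  proof induction
    case one
    show ?case by (intro bexI[of _ 1]) auto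
  next
    case (incl h)
    then obtain i where "h = x i" "i < r" by auto
    then show ?case
      by (intro bexI[of _ "if u i = 0 then 1 else - 1"]) (auto simp: chi_mult_generator)
  next
    case (inv h)
    then obtain i where "h = x i" "i < r" by auto
    then show ?case
      by (intro bexI[of _ "if u i = 0 then 1 else - 1"]) (auto simp: chi_mult_generator)
  next
    case (eng h1 h2)
    then have h: "h1 \<in> E" "h2 \<in> E" using generate_x by auto
    from eng obtain s1 s2 where s: "s1 \<in> {1, - 1}" "s2 \<in> {1, - 1}"
      "\<forall>g\<in>E. chi G x u r (g \<otimes> h1) = s1 * chi G x u r g"
      "\<forall>g\<in>E. chi G x u r (g \<otimes> h2) = s2 * chi G x u r g" by blast
    have "chi G x u r (g \<otimes> (h1 \<otimes> h2)) = s2 * s1 * chi G x u r g" if "g \<in> E" for g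
      using s(3,4) h that by (simp add: m_assoc[symmetric])
    moreover have "s2 * s1 \<in> {1, - 1}" using s(1,2) by auto
    ultimately show ?case by blast
  qed
qed

text \<open>By the triangle inequality, each factor at most doubles the sum of absolute values; this
  is the count of terms used in \<open>chi_one\<close>.\<close>

lemma sum_abs_chi_le: "j \<le> r \<Longrightarrow> (\<Sum>g\<in>E. \<bar>chi G x u j g\<bar>) \<le> 2 ^ j"
proof (induction j)
  case 0
  have "(\<Sum>g\<in>E. \<bar>chi G x u 0 g\<bar>) = (\<Sum>g\<in>E. if g = \<one> then 1 else 0)"
    by (rule sum.cong) (auto simp: gr_elem_def)
  then show ?case by simp
next
  case (Suc j)
  have x: "x j \<in> E" using Suc.prems by simp
  have "(\<Sum>g\<in>E. \<bar>chi G x u (Suc j) g\<bar>) \<le>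
      (\<Sum>g\<in>E. \<bar>chi G x u j g\<bar> + \<bar>chi G x u j (g \<otimes> x j)\<bar>)"
    using Suc.prems by (intro sum_mono) (auto simp: chi_Suc_E simp del: chi.simps)
  also have "\<dots> = (\<Sum>g\<in>E. \<bar>chi G x u j g\<bar>) + (\<Sum>g\<in>E. \<bar>chi G x u j (g \<otimes> x j)\<bar>)"
    by (rule sum.distrib)
  also have "(\<Sum>g\<in>E. \<bar>chi G x u j (g \<otimes> x j)\<bar>) = (\<Sum>g\<in>E. \<bar>chi G x u j g\<bar>)"
    by (rule sum.reindex_bij_witness[of _ "\<lambda>g. g \<otimes> x j" "\<lambda>g. g \<otimes> x j"])
       (use x in \<open>auto simp: m_assoc square_E\<close>)
  finally show ?case using Suc by simp
qed

lemma finite_U: "finite (U r)" and card_U: "card (U r) = 2 ^ r"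
proof -
  have UNIV_bit: "(UNIV :: bit set) = {0, 1}" by (auto intro: bit.exhaust)
  have b: "finite (UNIV :: bit set)" "card (UNIV :: bit set) = 2"
    unfolding UNIV_bit by simp_all
  show "finite (U r)" unfolding U_def using b by (intro finite_PiE) auto
  show "card (U r) = 2 ^ r" unfolding U_def using b by (simp add: card_PiE)
qed

text \<open>
  The number of terms in the expansion of $\chi_u$ gives $2^r |\chi_u(1)| \le 2^r$, while
  $\sum_u \chi_u = 2^r$ forces the average of the integers $\chi_u(1)$ to be $1$.
\<close>

lemma chi_one:
  assumes "u \<in> U r"
  shows "chi G x u r \<one> = 1"
proof -
  have le: "chi G x u r \<one> \<le> 1" for u
  proof -
    have "\<bar>chi G x u r e\<bar> = \<bar>chi G x u r \<one>\<bar>" if e: "e \<in> E" for e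
    proof -
      obtain s where "s \<in> {1, - 1}" "chi G x u r (\<one> \<otimes> e) = s * chi G x u r \<one>"
        using chi_mult_E[OF e, of u] E_one by blast
      then show ?thesis using e by auto
    qed
    then have "(\<Sum>e\<in>E. \<bar>chi G x u r e\<bar>) = (\<Sum>e\<in>E. \<bar>chi G x u r \<one>\<bar>)"
      by (intro sum.cong refl)
    also have "\<dots> = 2 ^ r * \<bar>chi G x u r \<one>\<bar>"
      using card_E by simp
    finally have "(\<Sum>e\<in>E. \<bar>chi G x u r e\<bar>) = 2 ^ r * \<bar>chi G x u r \<one>\<bar>" .
    then have "2 ^ r * \<bar>chi G x u r \<one>\<bar> \<le> 2 ^ r * 1"
      using sum_abs_chi_le[of r u] by simp
    then have "\<bar>chi G x u r \<one>\<bar> \<le> 1" by (rule mult_left_le_imp_le) simp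
    then show ?thesis by simp
  qed
  have "(\<Sum>u\<in>U r. chi G x u r \<one>) = 2 ^ r"
    using fun_cong[OF sum_chi[of x r], of \<one>] x_in by (auto simp: gr_scale_def gr_elem_def Pi_iff)
  then have "(\<Sum>u\<in>U r. 1 - chi G x u r \<one>) = 0"
    using card_U by (simp add: sum_subtractf)
  then show ?thesis
    using assms finite_U le by (subst (asm) sum_nonneg_eq_0_iff) auto
qed

lemma chi_character:
  assumes "u \<in> U r"
  shows "chi G x u r \<in> pm_characters E"
proof -
  have s: "chi G x u r e \<in> {1, - 1} \<and> (\<forall>g\<in>E. chi G x u r (g \<otimes> e) = chi G x u r e * chi G x u r g)"
    if e: "e \<in> E" for e
  proof -
    obtain s where s: "s \<in> {1, - 1}" "\<forall>g\<in>E. chi G x u r (g \<otimes> e) = s * chi G x u r g"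
      using chi_mult_E[OF e, of u] by blast
    then have "chi G x u r (\<one> \<otimes> e) = s * chi G x u r \<one>" by simp
    then have "chi G x u r e = s" using e chi_one[OF assms] by simp
    with s show ?thesis by simp
  qed
  then show ?thesis using chi_in_E by (auto simp: pm_characters_def mult.commute)
qed

lemma chi_generator:
  assumes "u \<in> U r" "i < r"
  shows "chi G x u r (x i) = (if u i = 0 then 1 else - 1)"
  using chi_mult_generator[of r i \<one> u] chi_one[OF assms(1)] assms(2) by simp

lemma inj_chi: "inj_on (\<lambda>u. chi G x u r) (U r)"
proof (rule inj_onI)
  fix u v assume uv: "u \<in> U r" "v \<in> U r" "chi G x u r = chi G x v r"
  have "u i = v i" if "i < r" for i
    using chi_generator[OF uv(1) that] chi_generator[OF uv(2) that] uv(3)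
    by (cases "u i"; cases "v i") auto
  then show "u = v" using uv(1,2) by (auto simp: U_def intro: PiE_ext)
qed

lemma character_ext:
  assumes "\<psi> \<in> pm_characters E" "\<phi> \<in> pm_characters E" "\<And>i. i < r \<Longrightarrow> \<psi> (x i) = \<phi> (x i)"
  shows "\<psi> = \<phi>"
proof
  fix e
  have at_one: "\<theta> \<one> = 1" if "\<theta> \<in> pm_characters E" for \<theta>
  proof -
    have "\<theta> (\<one> \<otimes> \<one>) = \<theta> \<one> * \<theta> \<one>" "\<theta> \<one> \<in> {1, - 1}"
      using that E_one unfolding pm_characters_def by blast+
    then show ?thesis by auto
  qed
  show "\<psi> e = \<phi> e"
  proof (cases "e \<in> E")
    case True
    then have "e \<in> generate G (x ` {..<r})" using generate_x by simp
    then show ?thesis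
    proof induction
      case one
      show ?case using assms(1,2) by (simp add: at_one)
    next
      case (eng a b)
      then have "a \<in> E" "b \<in> E" using generate_x by auto
      then show ?case using eng.IH assms(1,2) by (simp add: pm_characters_def)
    qed (use assms(3) in auto)
  qed (use assms in \<open>auto simp: pm_characters_def gr_onD\<close>)
qed

text \<open>Together with \<open>inj_chi\<close> this turns sums over u into sums over all
  characters, which conjugation can permute.\<close>

lemma image_chi: "(\<lambda>u. chi G x u r) ` U r = pm_characters E"
proof (intro equalityI subsetI)
  fix \<psi> assume \<psi>: "\<psi> \<in> pm_characters E"
  \<comment> \<open>The coordinates are read off from the signs at the generators; restriction to
    \<open>{..<r}\<close> makes the tuple an element of the extensional space
    \<open>U r\<close>.\<close>
  define u where "u = (\<lambda>i\<in>{..<r}. if \<psi> (x i) = 1 then 0 else 1 :: bit)"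
  have u: "u \<in> U r" by (simp add: u_def U_def)
  have "\<psi> (x i) = chi G x u r (x i)" if "i < r" for i
  proof -
    have "\<psi> (x i) \<in> {1, - 1}" using \<psi> that x_E by (auto simp: pm_characters_def simp del: x_E)
    then show ?thesis using chi_generator[OF u that] that by (auto simp: u_def)
  qed
  then have "\<psi> = chi G x u r" using \<psi> chi_character[OF u] character_ext by blast
  then show "\<psi> \<in> (\<lambda>u. chi G x u r) ` U r" using u by blast
qed (use chi_character in auto)

lemma card_characters: "card (pm_characters E) = 2 ^ r"
  and finite_characters: "finite (pm_characters E)"
  using card_image[OF inj_chi] card_U finite_imageI[OF finite_U, of "\<lambda>u. chi G x u r"]
  by (simp_all add: image_chi)

lemma sum_characters: "(\<lambda>g. \<Sum>\<psi>\<in>pm_characters E. \<psi> g) = gr_scale (2 ^ r) (gr_elem \<one>)"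
proof -
  have "(\<Sum>\<psi>\<in>pm_characters E. \<psi> g) = (\<Sum>u\<in>U r. chi G x u r g)" for g
    unfolding image_chi[symmetric] sum.reindex[OF inj_chi] by simp
  then show ?thesis using sum_chi[of x r] by simp
qed

text \<open>Elements of \<open>E\<close> are their own inverses. Hence a product of one block with
  the inverse of another contains a plain product of two characters.\<close>

lemma gr_inv_character:
  assumes "\<psi> \<in> pm_characters E"
  shows "gr_inv G \<psi> = \<psi>"
proof
  fix g
  show "gr_inv G \<psi> g = \<psi> g"
  proof (cases "g \<in> E")
    case True
    then show ?thesis by (simp add: gr_inv_def)
  next
    case False
    moreover from False have "inv g \<notin> E" if "g \<in> carrier G"
      using that E_inv[of "inv g"] by auto
    ultimately show ?thesis using assms by (auto simp: gr_inv_def pm_characters_def gr_onD)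
  qed
qed

text \<open>Orthogonality in the group ring: \<open>\<phi> (inv a \<otimes> g)\<close> splits as
  \<open>\<phi> a * \<phi> g\<close> on \<open>E\<close>, so the convolution is the inner product of
  the characters times \<open>\<phi>\<close>.\<close>

lemma character_mult:
  assumes "\<psi> \<in> pm_characters E" "\<phi> \<in> pm_characters E"
  shows "\<psi> \<star> \<phi> = gr_scale (if \<psi> = \<phi> then 2 ^ r else 0) \<phi>"
proof
  fix g
  show "(\<psi> \<star> \<phi>) g = gr_scale (if \<psi> = \<phi> then 2 ^ r else 0) \<phi> g"
  proof (cases "g \<in> E")
    case False
    then have "(\<psi> \<star> \<phi>) g = 0" "\<phi> g = 0"
      using gr_mult_on_subgroup[OF subgroup_E] assms by (auto simp: pm_characters_def intro: gr_onD)
    then show ?thesis by (simp add: gr_scale_def)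
  next
    case True
    have "(\<psi> \<star> \<phi>) g = (\<Sum>a\<in>carrier G. \<psi> a * \<phi> (inv a \<otimes> g))"
      using True by (simp add: gr_mult_eq)
    also have "\<dots> = (\<Sum>a\<in>E. \<psi> a * \<phi> (inv a \<otimes> g))"
      using assms by (intro sum.mono_neutral_right) (auto simp: pm_characters_def gr_onD)
    also have "\<dots> = (\<Sum>a\<in>E. \<psi> a * \<phi> a) * \<phi> g"
      using True assms by (simp add: sum_distrib_right pm_characters_def mult.assoc)
    also have "(\<Sum>a\<in>E. \<psi> a * \<phi> a) = (if \<psi> = \<phi> then 2 ^ r else 0)"
    proof (cases "\<psi> = \<phi>")
      case True
      have "\<phi> a * \<phi> a = 1" if "a \<in> E" for a
        using that assms(2) unfolding pm_characters_def by fastforce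
      then show ?thesis using True card_E by simp
    next
      case False
      then obtain i where i: "i < r" "\<psi> (x i) \<noteq> \<phi> (x i)" using assms character_ext by blast
      let ?S = "\<Sum>a\<in>E. \<psi> a * \<phi> a"
      have e: "x i \<in> E" using i by simp
      have "\<psi> (x i) \<in> {1, - 1}" "\<phi> (x i) \<in> {1, - 1}"
        using assms e unfolding pm_characters_def by blast+
      with i have m: "\<psi> (x i) * \<phi> (x i) = - 1" by auto
      \<comment> \<open>Translation by a generator at which the two signs differ replaces the inner
        product by its negative.\<close>
      have "?S = (\<Sum>a\<in>E. \<psi> (x i \<otimes> a) * \<phi> (x i \<otimes> a))"
        by (rule sum.reindex_bij_witness[of _ "\<lambda>a. x i \<otimes> a" "\<lambda>a. x i \<otimes> a"])
           (use e in \<open>auto simp: m_assoc[symmetric] square_E\<close>)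
      also have "\<dots> = (\<Sum>a\<in>E. (\<psi> (x i) * \<phi> (x i)) * (\<psi> a * \<phi> a))"
        using assms e by (intro sum.cong) (auto simp: pm_characters_def)
      also have "\<dots> = - ?S" unfolding m by (simp add: sum_negf)
      finally show ?thesis using False by simp
    qed
    finally show ?thesis by (simp add: gr_scale_def)
  qed
qed

end

section \<open>Coset representatives in \<open>K\<close>, single blocks and orbits of
  characters\<close>

section \<open>Signature blocks and the action on the characters\<close>

text \<open>Convolution yields conditions on \<open>inv a \<otimes> b\<close>, which describe left
  cosets, while \<open>rcosets\<close> consists of right cosets; normality identifies them.\<close>

lemma (in group) mem_rcoset_normal_iff:
  assumes "H \<lhd> G" "a \<in> carrier G" "b \<in> carrier G"
  shows "a \<in> H #> b \<longleftrightarrow> inv a \<otimes> b \<in> H"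
proof -
  have H: "subgroup H G" using assms(1) by (rule normal_imp_subgroup)
  have "a \<in> H #> b \<longleftrightarrow> a \<in> b <# H" using normal.coset_eq assms by blast
  also have "\<dots> \<longleftrightarrow> (\<exists>h\<in>H. a = b \<otimes> h)" by (auto simp: l_coset_def)
  also have "\<dots> \<longleftrightarrow> inv b \<otimes> a \<in> H"
  proof
    assume "\<exists>h\<in>H. a = b \<otimes> h"
    then obtain h where h: "h \<in> H" "a = b \<otimes> h" by blast
    moreover have "h \<in> carrier G" using H h(1) by (rule subgroup.mem_carrier)
    ultimately show "inv b \<otimes> a \<in> H" using assms by (simp add: m_assoc[symmetric])
  next
    assume "inv b \<otimes> a \<in> H"
    then show "\<exists>h\<in>H. a = b \<otimes> h"
      using assms by (intro bexI[of _ "inv b \<otimes> a"]) (simp_all add: m_assoc[symmetric])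
  qed
  also have "\<dots> \<longleftrightarrow> inv a \<otimes> b \<in> H"
    using subgroup.m_inv_closed[OF H, of "inv b \<otimes> a"] subgroup.m_inv_closed[OF H, of "inv a \<otimes> b"]
      assms by (auto simp: inv_mult_group)
  finally show ?thesis .
qed

locale signature_subgroup = elementary_abelian_subgroup +
  fixes K :: "'a set"
  assumes normal_E: "E \<lhd> G" and normal_K: "K \<lhd> G" and E_K: "E \<subseteq> K"
begin

lemma subgroup_K: "subgroup K G"
  using normal_K by (rule normal_imp_subgroup)

lemma K_carrier [simp]: "a \<in> K \<Longrightarrow> a \<in> carrier G"
  using subgroup_K by (rule subgroup.mem_carrier)

lemma coset_representatives_ex1:
  assumes T: "coset_representatives (G\<lparr>carrier := K\<rparr>) E T" and k: "k \<in> K"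
  shows "\<exists>!t. t \<in> T \<and> inv t \<otimes> k \<in> E"
proof -
  have "T \<subseteq> K" using T by (simp add: coset_representatives_def)
  then have "t \<in> T \<and> inv t \<otimes> k \<in> E \<longleftrightarrow> t \<in> T \<inter> (E #> k)" for t
    using k mem_rcoset_normal_iff[OF normal_E] by auto
  moreover have "E #> k \<in> rcosets\<^bsub>G\<lparr>carrier := K\<rparr>\<^esub> E"
    using k by (auto simp: RCOSETS_def r_coset_def)
  then have "\<exists>!t. t \<in> T \<inter> (E #> k)" using T unfolding coset_representatives_def by blast
  ultimately show ?thesis by simp
qed

text \<open>Multiplication is a bijection from \<open>T \<times> E\<close> onto \<open>K\<close>.
  Thus the constant |K|/2^r of the block equation is the number of representatives.\<close>

lemma card_coset_representatives:
  assumes T: "coset_representatives (G\<lparr>carrier := K\<rparr>) E T"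
  shows "card K = card T * 2 ^ r"
proof -
  have TK: "T \<subseteq> K" using T by (simp add: coset_representatives_def)
  have t: "t \<in> carrier G" if "t \<in> T" for t using that TK by auto
  have "inj_on (\<lambda>(t, e). t \<otimes> e) (T \<times> E)"
  proof (rule inj_onI, clarify)
    fix s e t f
    assume h: "s \<in> T" "e \<in> E" "t \<in> T" "f \<in> E" "s \<otimes> e = t \<otimes> f"
    have "s \<otimes> e \<in> K"
      using h TK E_K subgroup.m_closed[OF subgroup_K] by auto
    moreover have "inv a \<otimes> (a \<otimes> b) = b" if "a \<in> T" "b \<in> E" for a b
      using that t by (simp add: m_assoc[symmetric])
    then have "inv s \<otimes> (s \<otimes> e) = e" "inv t \<otimes> (t \<otimes> f) = f"
      using h by blast+
    ultimately have "s = t"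
      using coset_representatives_ex1[OF T, of "s \<otimes> e"] h by metis
    then show "s = t \<and> e = f" using h t by simp
  qed
  moreover have "(\<lambda>(t, e). t \<otimes> e) ` (T \<times> E) = K"
  proof (intro equalityI subsetI)
    fix k assume k: "k \<in> K"
    then obtain s where s: "s \<in> T" "inv s \<otimes> k \<in> E"
      using coset_representatives_ex1[OF T] by blast
    then have "k = s \<otimes> (inv s \<otimes> k)" using k t by (simp add: m_assoc[symmetric])
    with s show "k \<in> (\<lambda>(t, e). t \<otimes> e) ` (T \<times> E)"
      by (intro image_eqI[of _ _ "(s, inv s \<otimes> k)"]) auto
  qed (use TK E_K subgroup.m_closed[OF subgroup_K] in auto)
  ultimately have "card K = card (T \<times> E)" by (metis card_image)
  then show ?thesis by (simp add: card_cartesian_product card_E)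
qed

context
  fixes u A T
  assumes u: "u \<in> U r"
    and T: "coset_representatives (G\<lparr>carrier := K\<rparr>) E T"
    and A_T: "\<And>g. g \<in> T \<Longrightarrow> A g \<in> {1, - 1}"
    and A_on: "A \<in> gr_on T"
begin

lemma T_K: "T \<subseteq> K"
  using T by (simp add: coset_representatives_def)

lemma T_carrier: "t \<in> T \<Longrightarrow> t \<in> carrier G"
  using T_K by auto

lemma block_mult_apply:
  "g \<in> carrier G \<Longrightarrow> (A \<star> B) g = (\<Sum>t\<in>T. A t * B (inv t \<otimes> g))"
  using T_carrier unfolding gr_mult_eq
  by (simp, intro sum.mono_neutral_right) (auto simp: gr_onD[OF A_on])

text \<open>The translates tE tile \<open>K\<close>, so exactly one representative contributes at
  \<open>k\<close>, with a product of two signs. This makes the final function plus or minus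
  1.\<close>

lemma block_chi_values:
  assumes k: "k \<in> K"
  shows "(A \<star> chi G x u r) k \<in> {1, - 1}"
proof -
  obtain t where t: "t \<in> T" "inv t \<otimes> k \<in> E"
    and uniq: "\<And>s. s \<in> T \<Longrightarrow> inv s \<otimes> k \<in> E \<Longrightarrow> s = t"
    using coset_representatives_ex1[OF T k] by blast
  have "(A \<star> chi G x u r) k = (\<Sum>s\<in>T. A s * chi G x u r (inv s \<otimes> k))"
    using k by (simp add: block_mult_apply)
  also have "\<dots> = (\<Sum>s\<in>{t}. A s * chi G x u r (inv s \<otimes> k))"
  proof (rule sum.mono_neutral_right)
    show "finite T" using T_K finite_subset subgroup.subset[OF subgroup_K] finite_carrier by metis
    show "\<forall>s\<in>T - {t}. A s * chi G x u r (inv s \<otimes> k) = 0"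
      using uniq gr_onD[OF chi_in_E] by fastforce
  qed (use t in auto)
  also have "\<dots> = A t * chi G x u r (inv t \<otimes> k)" by simp
  also have "\<dots> \<in> {1, - 1}"
    using A_T[OF t(1)] chi_character[OF u] t(2) by (auto simp: pm_characters_def)
  finally show ?thesis .
qed

text \<open>Expanding the block equation at \<open>e\<close> produces the arguments
  \<open>inv s \<otimes> e\<close>. Since s^{-1} e = (s^{-1} e s) s^{-1}, the conjugate of
  \<open>e\<close> appears.\<close>

lemma chi_block_inv_apply:
  assumes s: "s \<in> T" and e: "e \<in> E"
  shows "(chi G x u r \<star> gr_inv G A) (inv s \<otimes> e) = chi G x u r (inv s \<otimes> e \<otimes> s) * A s"
proof -
  let ?f = "inv s \<otimes> e \<otimes> s"
  have sG: "s \<in> carrier G" and sK: "s \<in> K" using s T_K by auto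
  have f: "?f \<in> E" using conj_mem_iff[OF normal_E sG, of e] e by simp
  \<comment> \<open>The coefficient is \<open>A\<close> at e s a, an element of sE by normality. It
    lies in \<open>T\<close> only when it equals \<open>s\<close>, which means that \<open>a\<close>
    is the conjugate \<open>?f\<close>.\<close>
  have *: "gr_inv G A (inv a \<otimes> (inv s \<otimes> e)) = (if a = ?f then A s else 0)" if a: "a \<in> E" for a
  proof -
    have "inv (inv a \<otimes> (inv s \<otimes> e)) = e \<otimes> s \<otimes> a"
      using a e sG by (simp add: inv_mult_group)
    then have eq: "gr_inv G A (inv a \<otimes> (inv s \<otimes> e)) = A (e \<otimes> s \<otimes> a)"
      using a e sG by (simp add: gr_inv_def)
    show ?thesis
    proof (cases "e \<otimes> s \<otimes> a \<in> T")
      case True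
      have "inv (e \<otimes> s \<otimes> a) \<otimes> s = a \<otimes> (inv s \<otimes> e \<otimes> s)"
        using a e sG by (simp add: inv_mult_group m_assoc)
      then have "inv (e \<otimes> s \<otimes> a) \<otimes> s \<in> E" using a f by simp
      moreover have "inv s \<otimes> s \<in> E" using sG by simp
      ultimately have "e \<otimes> s \<otimes> a = s"
        using coset_representatives_ex1[OF T sK] True s by blast
      moreover from this have "inv s \<otimes> e \<otimes> (e \<otimes> s \<otimes> a) = ?f" by simp
      then have "a = ?f"
        using a e sG square_E[OF e] by (simp add: m_assoc[symmetric]) 
          (simp add: m_assoc square_E[OF e] flip: m_assoc[of e e])
      ultimately show ?thesis using eq by simp
    next
      case False
      have "e \<otimes> s \<otimes> ?f = (e \<otimes> s \<otimes> inv s \<otimes> e) \<otimes> s" using e sG by (simp add: m_assoc[symmetric])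
      also have "e \<otimes> s \<otimes> inv s \<otimes> e = \<one>" using e sG by (simp add: inv_cancel square_E)
      finally have "e \<otimes> s \<otimes> ?f = s" using sG by simp
      with False s have "a \<noteq> ?f" by auto
      then show ?thesis using eq False gr_onD[OF A_on] by simp
    qed
  qed
  have "(chi G x u r \<star> gr_inv G A) (inv s \<otimes> e) =
      (\<Sum>a\<in>carrier G. chi G x u r a * gr_inv G A (inv a \<otimes> (inv s \<otimes> e)))"
    using e sG by (simp add: gr_mult_eq)
  also have "\<dots> = (\<Sum>a\<in>E. chi G x u r a * gr_inv G A (inv a \<otimes> (inv s \<otimes> e)))"
    by (intro sum.mono_neutral_right) (auto simp: gr_onD[OF chi_in_E])
  also have "\<dots> = (\<Sum>a\<in>E. if a = ?f then chi G x u r a * A s else 0)"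
    using * by (intro sum.cong) auto
  finally show ?thesis using f by simp
qed

text \<open>
  Both sides of the block equation are compared at $e \in E$: on the left $\chi_u(e)$ is replaced
  by the sum of the $|T|$ signs $\chi_u(t^{-1} e t)$, so all of them must agree.
\<close>

lemma block_fixes_chi:
  assumes eq: "A \<star> chi G x u r \<star> gr_inv G A = gr_scale (int (card T)) (chi G x u r)"
    and k: "k \<in> K"
  shows "gr_conj k (chi G x u r) = chi G x u r"
proof -
  let ?\<psi> = "chi G x u r"
  have \<psi>: "?\<psi> \<in> pm_characters E" by (rule chi_character[OF u])
  have finT: "finite T" using T_K finite_subset subgroup.subset[OF subgroup_K] finite_carrier by metis
  have fixed: "?\<psi> (inv s \<otimes> e \<otimes> s) = ?\<psi> e" if e: "e \<in> E" and s: "s \<in> T" for e s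
  proof -
    have sgn: "?\<psi> a \<in> {1, - 1}" if "a \<in> E" for a using \<psi> that by (auto simp: pm_characters_def)
    have cE: "inv t \<otimes> e \<otimes> t \<in> E" if "t \<in> T" for t
      using conj_mem_iff[OF normal_E T_carrier[OF that], of e] e by simp
    have "int (card T) * ?\<psi> e = (A \<star> (?\<psi> \<star> gr_inv G A)) e"
      using fun_cong[OF eq, of e] by (simp add: gr_scale_def gr_mult_assoc)
    also have "\<dots> = (\<Sum>t\<in>T. A t * (?\<psi> (inv t \<otimes> e \<otimes> t) * A t))"
      using e by (simp add: block_mult_apply chi_block_inv_apply)
    also have "\<dots> = (\<Sum>t\<in>T. ?\<psi> (inv t \<otimes> e \<otimes> t))"
    proof (rule sum.cong[OF refl])
      fix t assume "t \<in> T"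
      then show "A t * (?\<psi> (inv t \<otimes> e \<otimes> t) * A t) = ?\<psi> (inv t \<otimes> e \<otimes> t)"
        using A_T[of t] by auto
    qed
    finally have "int (card T) * ?\<psi> e = (\<Sum>t\<in>T. ?\<psi> (inv t \<otimes> e \<otimes> t))" .
    then have "(\<Sum>t\<in>T. ?\<psi> (inv t \<otimes> e \<otimes> t)) * ?\<psi> e = int (card T) * (?\<psi> e * ?\<psi> e)"
      by (simp add: mult.assoc)
    also have "?\<psi> e * ?\<psi> e = 1" using sgn[OF e] by auto
    \<comment> \<open>After multiplication by the sign at \<open>e\<close>, each summand is 0 or 2,
      so the zero sum makes every summand vanish.\<close>
    finally have "(\<Sum>t\<in>T. 1 - ?\<psi> (inv t \<otimes> e \<otimes> t) * ?\<psi> e) = 0"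
      by (simp add: sum_subtractf sum_distrib_right)
    moreover have "0 \<le> 1 - ?\<psi> (inv t \<otimes> e \<otimes> t) * ?\<psi> e" if "t \<in> T" for t
      using sgn[OF cE[OF that]] sgn[OF e] by auto
    ultimately have "1 - ?\<psi> (inv s \<otimes> e \<otimes> s) * ?\<psi> e = 0"
      using finT s by (subst (asm) sum_nonneg_eq_0_iff) auto
    then show ?thesis using sgn[OF cE[OF s]] sgn[OF e] by auto
  qed
  have ext: "gr_conj g ?\<psi> = ?\<psi>" if g: "g \<in> carrier G" and "\<And>e. e \<in> E \<Longrightarrow> ?\<psi> (inv g \<otimes> e \<otimes> g) = ?\<psi> e" for g
  proof
    fix e
    show "gr_conj g ?\<psi> e = ?\<psi> e"
    proof (cases "e \<in> E")
      case False
      moreover have "gr_conj g ?\<psi> \<in> gr_on E"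
        using gr_conj_characters[OF normal_E g \<psi>] by (simp add: pm_characters_def)
      ultimately show ?thesis using gr_onD chi_in_E by metis
    qed (use that in \<open>simp add: gr_conj_apply\<close>)
  qed
  obtain s where s: "s \<in> T" "inv s \<otimes> k \<in> E" using coset_representatives_ex1[OF T k] by blast
  define e where "e = inv s \<otimes> k"
  have e: "e \<in> E" and sG: "s \<in> carrier G" using s e_def T_carrier by auto
  \<comment> \<open>The representative \<open>s\<close> fixes the character by \<open>fixed\<close>,
    and \<open>e\<close> fixes it because \<open>E\<close> is abelian.\<close>
  have "k = s \<otimes> e" using k sG by (simp add: e_def m_assoc[symmetric])
  then have "gr_conj k ?\<psi> = gr_conj s (gr_conj e ?\<psi>)" using e sG by (simp add: gr_conj_mult)
  also have "gr_conj e ?\<psi> = ?\<psi>"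
  proof (rule ext)
    fix a assume a: "a \<in> E"
    have "inv e \<otimes> a \<otimes> e = a"
      using a e by (simp add: E_comm[of e a]) (simp add: m_assoc square_E)
    then show "?\<psi> (inv e \<otimes> a \<otimes> e) = ?\<psi> a" by simp
  qed (use e in simp)
  also have "gr_conj s ?\<psi> = ?\<psi>" using ext sG fixed s(1) by blast
  finally show ?thesis .
qed

end

text \<open>This character is fixed by conjugation and supplies the singleton block required by
  \<open>transversal_of_blocks\<close>.\<close>

lemma trivial_character: "(\<lambda>g. if g \<in> E then 1 else 0) \<in> pm_characters E"
  by (auto simp: pm_characters_def gr_on_def)

lemma gr_conj_trivial_character:
  assumes "g \<in> carrier G"
  shows "gr_conj g (\<lambda>g. if g \<in> E then 1 else 0) = (\<lambda>g. if g \<in> E then 1 else 0)" (is "_ = ?\<tau>")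
proof
  fix e
  show "gr_conj g ?\<tau> e = ?\<tau> e"
    using gr_onD[OF gr_mult_on, of e] conj_mem_iff[OF normal_E assms, of e] assms
    by (cases "e \<in> carrier G") (simp_all add: gr_conj_apply, auto simp: gr_conj_def)
qed

text \<open>\<open>BijGroup\<close> consists of extensional bijections, hence the restriction of the
  conjugation maps to the set of characters.\<close>

lemma conj_action: "group_action G (pm_characters E) (\<lambda>g. \<lambda>\<psi>\<in>pm_characters E. gr_conj g \<psi>)"
proof -
  let ?X = "pm_characters E"
  have cl: "gr_conj g \<psi> \<in> ?X" if "g \<in> carrier G" "\<psi> \<in> ?X" for g \<psi>
    using gr_conj_characters[OF normal_E that] .
  have one: "gr_conj \<one> \<psi> = \<psi>" if "\<psi> \<in> ?X" for \<psi>
  proof (rule gr_conj_one)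
    have "\<psi> \<in> gr_on E" using that by (simp add: pm_characters_def)
    then show "\<psi> \<in> gr_on (carrier G)" by (rule gr_on_mono) auto
  qed
  have bij: "(\<lambda>\<psi>\<in>?X. gr_conj g \<psi>) \<in> Bij ?X" if g: "g \<in> carrier G" for g
  proof -
    have "bij_betw (gr_conj g) ?X ?X"
      by (rule bij_betw_byWitness[of _ "gr_conj (inv g)"])
         (use g cl one in \<open>auto simp flip: gr_conj_mult\<close>)
    then show ?thesis by (simp add: Bij_def cong: bij_betw_cong)
  qed
  have "(\<lambda>g. \<lambda>\<psi>\<in>?X. gr_conj g \<psi>) \<in> hom G (BijGroup ?X)"
    using bij cl by (auto simp: hom_def BijGroup_def compose_def gr_conj_mult fun_eq_iff)
  then show ?thesis
    by (simp add: group_action_def group_hom_def group_hom_axioms_def group_BijGroup is_group)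
qed

text \<open>The array has cosets as rows, characters as columns and conjugates as entries; its
  invariant blocks are the orbits.\<close>

lemma conj_transversal:
  assumes idx: "card (rcosets K) = 2 ^ r"
    and fixes_K: "\<And>k \<psi>. k \<in> K \<Longrightarrow> \<psi> \<in> pm_characters E \<Longrightarrow> gr_conj k \<psi> = \<psi>"
    and rep: "\<And>C. C \<in> rcosets K \<Longrightarrow> rep C \<in> carrier G"
  obtains \<rho> where "bij_betw \<rho> (pm_characters E) (rcosets K)"
    and "bij_betw (\<lambda>\<psi>. gr_conj (rep (\<rho> \<psi>)) \<psi>) (pm_characters E) (pm_characters E)"
proof -
  let ?X = "pm_characters E" and ?\<phi> = "\<lambda>g. \<lambda>\<psi>\<in>pm_characters E. gr_conj g \<psi>"
  interpret act: group_action G ?X ?\<phi> by (rule conj_action)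
  let ?Q = "orbits G ?X ?\<phi>"
  have UQ: "\<Union>?Q = ?X" by (rule act.orbits_coverture)
  have finB: "finite B" if "B \<in> ?Q" for B
    using that UQ finite_characters finite_subset by (metis Union_upper)
  have finQ: "finite ?Q" using UQ finite_characters by (metis finite_UnionD)
  have fin_rcosets: "finite (rcosets K)" using idx card.infinite by fastforce
  \<comment> \<open>The stabilizer contains \<open>K\<close>, so the orbit size, being its index,
    divides the index 2^r of \<open>K\<close>.\<close>
  have dvd: "card B dvd 2 ^ r" if "B \<in> ?Q" for B
  proof -
    obtain \<psi> where \<psi>: "\<psi> \<in> ?X" "B = orbit G ?\<phi> \<psi>" using \<open>B \<in> ?Q\<close> by (auto simp: orbits_def)
    let ?S = "stabilizer G ?\<phi> \<psi>"
    have S: "subgroup ?S G" by (rule act.stabilizer_subgroup[OF \<psi>(1)])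
    have "K \<subseteq> ?S" using \<psi>(1) fixes_K by (auto simp: stabilizer_def)
    then have "subgroup K (G\<lparr>carrier := ?S\<rparr>)" using subgroup_incl[OF subgroup_K S] by simp
    then have "card (rcosets\<^bsub>G\<lparr>carrier := ?S\<rparr>\<^esub> K) * card K = card ?S"
      using group.lagrange[OF subgroup_imp_group[OF S]] by (simp add: order_def)
    then have "card K dvd card ?S" by (metis dvd_triv_right)
    then obtain m where m: "card ?S = card K * m" by blast
    have "card B * card ?S = order G" using act.orbit_stabilizer_theorem \<psi> by simp
    also have "\<dots> = 2 ^ r * card K" using lagrange[OF subgroup_K] idx by simp
    finally have "card K * (card B * m) = card K * 2 ^ r" unfolding m by (simp add: mult_ac)
    moreover have "card K \<noteq> 0"
      using subgroup.one_closed[OF subgroup_K] subgroup.subset[OF subgroup_K] finite_carrier finite_subset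
      by (metis card_eq_0_iff empty_iff)
    ultimately have "card B * m = 2 ^ r" by simp
    then show ?thesis by (metis dvd_triv_left)
  qed
  have "\<exists>\<rho>. \<rho> ` (\<Union>?Q) \<subseteq> rcosets K \<and> inj_on \<rho> (\<Union>?Q) \<and>
      inj_on (\<lambda>\<psi>. gr_conj (rep (\<rho> \<psi>)) \<psi>) (\<Union>?Q)"
  proof (rule transversal_of_blocks[where P = "\<lambda>C. gr_conj (rep C)"])
    show "disjoint ?Q" using act.disjoint_union by (auto simp: disjoint_def)
    show "card (rcosets K) = card (\<Union>?Q)" using UQ idx card_characters by simp
    show "\<exists>k. card B = 2 ^ k" if "B \<in> ?Q" for B
      using dvd[OF that] divides_primepow_nat[of 2 "card B" r] by auto
    show "card B dvd card (rcosets K)" if "B \<in> ?Q" for B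
      using dvd[OF that] idx by simp
    show "\<exists>B\<in>?Q. card B = 1"
    proof -
      let ?\<tau> = "\<lambda>g. if g \<in> E then 1 else 0"
      have "orbit G ?\<phi> ?\<tau> = {?\<tau>}"
        using trivial_character gr_conj_trivial_character
        by (auto simp: orbit_def intro!: exI[of _ \<one>])
      then show ?thesis using trivial_character by (force simp: orbits_def)
    qed
    fix C B assume C: "C \<in> rcosets K" and B: "B \<in> ?Q"
    have BX: "B \<subseteq> ?X" using B UQ by blast
    have eq: "gr_conj (rep C) \<psi> = ?\<phi> (rep C) \<psi>" if "\<psi> \<in> B" for \<psi> using that BX by auto
    show "inj_on (gr_conj (rep C)) B"
      using inj_on_subset[OF act.inj_prop[OF rep[OF C]] BX] eq by (simp add: inj_on_def)
    obtain \<psi> where \<psi>: "\<psi> \<in> ?X" "B = orbit G ?\<phi> \<psi>" using B by (auto simp: orbits_def)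
    show "gr_conj (rep C) ` B \<subseteq> B"
    proof (intro image_subsetI)
      fix \<theta> assume \<theta>: "\<theta> \<in> B"
      then obtain g where g: "g \<in> carrier G" "\<theta> = ?\<phi> g \<psi>" using \<psi> by (auto simp: orbit_def)
      have "gr_conj (rep C) \<theta> = ?\<phi> (rep C \<otimes> g) \<psi>"
        using g \<psi> rep[OF C] by (simp add: gr_conj_mult)
      then show "gr_conj (rep C) \<theta> \<in> B"
        unfolding \<psi>(2) orbit_def using g(1) rep[OF C] by blast
    qed
  qed (use finQ finB fin_rcosets in auto)
  then obtain \<rho> where \<rho>: "\<rho> ` ?X \<subseteq> rcosets K" "inj_on \<rho> ?X"
      "inj_on (\<lambda>\<psi>. gr_conj (rep (\<rho> \<psi>)) \<psi>) ?X"
    unfolding UQ by blast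
  show thesis
  proof (rule that)
    \<comment> \<open>There are as many cosets as characters, so injectivity already gives a
      bijection.\<close>
    have "\<rho> ` ?X = rcosets K"
      by (rule card_subset_eq[OF fin_rcosets \<rho>(1)]) (simp add: card_image[OF \<rho>(2)] idx card_characters)
    then show "bij_betw \<rho> ?X (rcosets K)" using \<rho>(2) by (simp add: bij_betw_def)
    have "(\<lambda>\<psi>. gr_conj (rep (\<rho> \<psi>)) \<psi>) ` ?X \<subseteq> ?X"
      using \<rho>(1) rep gr_conj_characters[OF normal_E] by blast
    then show "bij_betw (\<lambda>\<psi>. gr_conj (rep (\<rho> \<psi>)) \<psi>) ?X ?X"
      using \<rho>(3) endo_inj_surj[OF finite_characters] unfolding bij_betw_def by blast
  qed
qed

end

section \<open>Assembling the difference set from the signature blocks\<close>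

section \<open>The difference set\<close>

lemma C2_power_facts:
  shows "card (carrier (C2_power r)) = 2 ^ r"
    and "f \<in> carrier (C2_power r) \<Longrightarrow> f \<otimes>\<^bsub>C2_power r\<^esub> f = \<one>\<^bsub>C2_power r\<^esub>"
  by (auto simp: C2_power_def carrier_integer_mod_group card_PiE fun_eq_iff PiE_iff intro!: restrict_ext)

context signature_subgroup
begin

theorem signature_set_imp_hadamard:
  assumes idx: "card (rcosets K) = 2 ^ r"
    and sig: "signature_set (G\<lparr>carrier := K\<rparr>) E r x A"
  shows "\<exists>D. hadamard_difference_set G D"
proof -
  let ?X = "pm_characters E" and ?\<chi> = "\<lambda>u. chi G x u r"
  have x_K: "x \<in> {..<r} \<rightarrow> K" using x_in E_K by auto
  have \<chi>_K: "?\<chi> u \<in> gr_on K" for u using chi_in_E E_K by (rule gr_on_mono)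
  \<comment> \<open>The same constant serves all blocks, and it equals the number of representatives
    in each of them.\<close>
  define n where "n = int (card K div 2 ^ r)"
  have block: "\<exists>T. coset_representatives (G\<lparr>carrier := K\<rparr>) E T \<and> (\<forall>g\<in>T. A u g \<in> {1, - 1}) \<and>
      A u \<in> gr_on T \<and> n = int (card T)" if u: "u \<in> U r" for u
  proof -
    have "signature_block (G\<lparr>carrier := K\<rparr>) E r x u (A u)"
      using sig u by (simp add: signature_set_def)
    then obtain T where "coset_representatives (G\<lparr>carrier := K\<rparr>) E T" "\<forall>g\<in>T. A u g \<in> {1, - 1}"
      "A u \<in> gr_on T" unfolding signature_block_def gr_on_def by blast
    moreover from this have "n = int (card T)" by (simp add: n_def card_coset_representatives)
    ultimately show ?thesis by blast
  qed
  have A_K: "A u \<in> gr_on K" if "u \<in> U r" for u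
    using block[OF that] gr_on_mono by (auto simp: coset_representatives_def)
  have eq: "A u \<star> ?\<chi> u \<star> gr_inv G (A u) = gr_scale n (?\<chi> u)" if u: "u \<in> U r" for u
  proof -
    have "gr_inv G (A u) \<in> gr_on K"
      using A_K[OF u] subgroup.m_inv_closed[OF subgroup_K] 
      by (auto simp: gr_on_def gr_inv_def) (metis K_carrier inv_inv)
    moreover have "signature_block (G\<lparr>carrier := K\<rparr>) E r x u (A u)"
      using sig u by (simp add: signature_set_def)
    ultimately show ?thesis
      using A_K[OF u] \<chi>_K gr_mult_on_subgroup[OF subgroup_K A_K[OF u] \<chi>_K]
      by (simp add: signature_block_def chi_restrict[OF subgroup_K x_K] gr_mult_restrict[OF subgroup_K]
          gr_inv_restrict[OF subgroup_K] n_def order_def)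
  qed
  have fixes_K: "gr_conj k \<psi> = \<psi>" if k: "k \<in> K" and \<psi>: "\<psi> \<in> ?X" for k \<psi>
  proof -
    obtain u where u: "u \<in> U r" "\<psi> = ?\<chi> u" using \<psi> image_chi by blast
    then show ?thesis using block[OF u(1)] block_fixes_chi[OF u(1) _ _ _ _ k] eq[OF u(1)] by metis
  qed
  define B where "B u = A u \<star> ?\<chi> u" for u
  have B_K: "B u \<in> gr_on K" if "u \<in> U r" for u
    unfolding B_def using gr_mult_on_subgroup[OF subgroup_K A_K[OF that] \<chi>_K] .
  have B_pm: "B u k \<in> {1, - 1}" if "u \<in> U r" "k \<in> K" for u k
    unfolding B_def using block[OF that(1)] block_chi_values[OF that(1) _ _ _ that(2)] by metis
  \<comment> \<open>The characters meet in the middle, so orthogonality removes the terms with u and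
    v distinct before any relation between different blocks is needed; the block equation evaluates
    the diagonal.\<close>
  have B_mult: "B u \<star> gr_inv G (B v) = (if u = v then gr_scale (2 ^ r * n) (?\<chi> u) else (\<lambda>_. 0))"
    if u: "u \<in> U r" and v: "v \<in> U r" for u v
  proof -
    have "B u \<star> gr_inv G (B v) = A u \<star> (?\<chi> u \<star> ?\<chi> v) \<star> gr_inv G (A v)"
      by (simp add: B_def gr_inv_mult gr_inv_character[OF chi_character[OF v]] gr_mult_assoc)
    also have "?\<chi> u \<star> ?\<chi> v = gr_scale (if u = v then 2 ^ r else 0) (?\<chi> v)"
      using character_mult[OF chi_character[OF u] chi_character[OF v]] inj_onD[OF inj_chi _ u v] by auto
    also have "A u \<star> \<dots> \<star> gr_inv G (A v) =
        gr_scale (if u = v then 2 ^ r else 0) (A u \<star> ?\<chi> v \<star> gr_inv G (A v))"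
      by (simp only: gr_mult_scale_left gr_mult_scale_right)
    also have "\<dots> = (if u = v then gr_scale (2 ^ r * n) (?\<chi> u) else (\<lambda>_. 0))"
      using eq[OF v] by (cases "u = v") (auto simp: gr_scale_def mult.assoc)
    finally show ?thesis .
  qed

  define rep where "rep C = (SOME g. g \<in> carrier G \<and> C = K #> g)" for C
  have rep: "rep C \<in> carrier G \<and> C = K #> rep C" if "C \<in> rcosets K" for C
  proof -
    have "\<exists>g. g \<in> carrier G \<and> C = K #> g" using that by (auto simp: RCOSETS_def)
    then show ?thesis unfolding rep_def by (rule someI_ex)
  qed
  obtain \<rho> where \<rho>: "bij_betw \<rho> ?X (rcosets K)"
    and perm: "bij_betw (\<lambda>\<psi>. gr_conj (rep (\<rho> \<psi>)) \<psi>) ?X ?X"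
    using conj_transversal[OF idx fixes_K, of rep] rep by blast
  \<comment> \<open>These are the elements g_u: one from each coset of \<open>K\<close>, matched to
    the characters by \<open>\<rho>\<close>.\<close>
  define h where "h u = rep (\<rho> (?\<chi> u))" for u
  have bij_chi: "bij_betw ?\<chi> (U r) ?X" using inj_chi image_chi by (simp add: bij_betw_def)
  have bij: "bij_betw (\<lambda>u. \<rho> (?\<chi> u)) (U r) (rcosets K)"
    using bij_betw_trans[OF bij_chi \<rho>] by (simp add: o_def)
  have h: "h u \<in> carrier G" "\<rho> (?\<chi> u) = K #> h u" if "u \<in> U r" for u
    using rep bij_betwE[OF bij] that by (auto simp: h_def)

  define F where "F = (\<lambda>g. \<Sum>u\<in>U r. (gr_elem (h u) \<star> B u) g)"
  have F_pm: "F g \<in> {1, - 1}" if g: "g \<in> carrier G" for g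
  proof -
    have "K #> g \<in> rcosets K" using g by (auto simp: RCOSETS_def)
    then have "K #> g \<in> (\<lambda>u. \<rho> (?\<chi> u)) ` U r"
      using bij_betw_imp_surj_on[OF bij] by simp
    then obtain u where u: "u \<in> U r" "\<rho> (?\<chi> u) = K #> g" by auto
    \<comment> \<open>The summands of \<open>F\<close> are supported on distinct cosets of
      \<open>K\<close>, so only one of them is nonzero at \<open>g\<close>.\<close>
    have coset: "inv (h v) \<otimes> g \<in> K \<longleftrightarrow> v = u" if v: "v \<in> U r" for v
    proof -
      have "inv (h v) \<otimes> g \<in> K \<longleftrightarrow> h v \<in> K #> g"
        using mem_rcoset_normal_iff[OF normal_K h(1)[OF v] g] by simp
      also have "\<dots> \<longleftrightarrow> K #> h v = K #> g"
        using repr_independence[OF _ g subgroup_K] rcos_self[OF h(1)[OF v] subgroup_K] by auto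
      also have "\<dots> \<longleftrightarrow> v = u"
        using h(2)[OF v] u inj_onD[OF bij_betw_imp_inj_on[OF bij] _ v u(1)] by auto
      finally show ?thesis .
    qed
    have "(gr_elem (h v) \<star> B v) g = (if v = u then B u (inv (h u) \<otimes> g) else 0)"
      if "v \<in> U r" for v
      using gr_elem_mult_apply[OF h(1)[OF that] g] gr_onD[OF B_K[OF that]] coset[OF that] by auto
    then have "F g = B u (inv (h u) \<otimes> g)" using u(1) finite_U by (simp add: F_def)
    moreover have "inv (h u) \<otimes> g \<in> K" using coset u(1) by simp
    ultimately show ?thesis using B_pm u(1) by simp
  qed
  have F_0: "F g = 0" if "g \<notin> carrier G" for g
    using that gr_onD[OF gr_mult_on] by (simp add: F_def)
  define D where "D = {g \<in> carrier G. F g = - 1}"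
  have F_D: "pm_char_fun G D = F"
    using F_pm F_0 by (fastforce simp: pm_char_fun_def D_def)

  have product_term: "gr_elem (h u) \<star> B u \<star> gr_inv G (gr_elem (h v) \<star> B v) =
      (if v = u then gr_scale (2 ^ r * n) (gr_conj (h u) (?\<chi> u)) else (\<lambda>_. 0))"
    if u: "u \<in> U r" and v: "v \<in> U r" for u v
  proof -
    have "gr_elem (h u) \<star> B u \<star> gr_inv G (gr_elem (h v) \<star> B v) =
        gr_elem (h u) \<star> (B u \<star> gr_inv G (B v)) \<star> gr_elem (inv (h v))"
      by (simp add: gr_inv_mult gr_inv_elem[OF h(1)[OF v]] gr_mult_assoc)
    then show ?thesis
      unfolding B_mult[OF u v]
      by (auto simp: gr_mult_scale_left gr_mult_scale_right gr_mult_zero_left gr_mult_zero_right gr_conj_def)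
  qed
  have "F \<star> gr_inv G F = gr_scale (int (order G)) (gr_elem \<one>)"
  proof
    fix g
    have "(F \<star> gr_inv G F) g =
        (\<Sum>u\<in>U r. \<Sum>v\<in>U r. (gr_elem (h u) \<star> B u \<star> gr_inv G (gr_elem (h v) \<star> B v)) g)"
      unfolding F_def gr_inv_sum gr_mult_sum_left gr_mult_sum_right ..
    also have "\<dots> = (\<Sum>u\<in>U r. \<Sum>v\<in>U r.
        if v = u then gr_scale (2 ^ r * n) (gr_conj (h u) (?\<chi> u)) g else 0)"
      by (intro sum.cong refl) (simp add: product_term)
    also have "\<dots> = (\<Sum>u\<in>U r. 2 ^ r * n * gr_conj (h u) (?\<chi> u) g)"
      using finite_U by (simp add: gr_scale_def)
    \<comment> \<open>The index u is replaced by its character; then \<open>perm\<close> replaces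
      the conjugated characters by all characters, whose sum is known.\<close>
    also have "\<dots> = (\<Sum>\<psi>\<in>?X. 2 ^ r * n * gr_conj (rep (\<rho> \<psi>)) \<psi> g)"
      unfolding h_def by (rule sum.reindex_bij_betw[OF bij_chi])
    also have "\<dots> = (\<Sum>\<psi>\<in>?X. 2 ^ r * n * \<psi> g)"
      by (rule sum.reindex_bij_betw[OF perm])
    also have "\<dots> = 2 ^ r * n * gr_scale (2 ^ r) (gr_elem \<one>) g"
      using fun_cong[OF sum_characters, of g] by (simp flip: sum_distrib_left)
    also have "\<dots> = gr_scale (2 ^ r * (n * 2 ^ r)) (gr_elem \<one>) g"
      by (simp add: gr_scale_def)
    also have "2 ^ r * (n * 2 ^ r) = int (order G)"
    proof -
      \<comment> \<open>Any block will do: its representatives identify n 2^r with |K|.\<close>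
      obtain u where "u \<in> U r" using card_U by fastforce
      with block obtain T where T: "coset_representatives (G\<lparr>carrier := K\<rparr>) E T" "n = int (card T)"
        by blast
      have "order G = 2 ^ r * card K" using lagrange[OF subgroup_K] idx by simp
      then show ?thesis using T(2) card_coset_representatives[OF T(1)] by simp
    qed
    finally show "(F \<star> gr_inv G F) g = gr_scale (int (order G)) (gr_elem \<one>) g" .
  qed
  then have "hadamard_difference_set G D"
    unfolding hadamard_difference_set_def F_D by (auto simp: D_def)
  then show ?thesis by blast
qed

end

theorem theorem2p3:
  fixes G :: "('a, 'b) monoid_scheme" and E K :: "'a set" and r :: nat and x :: "nat \<Rightarrow> 'a"
  assumes "group G" and "finite (carrier G)"
    and "E \<lhd> G" and "G\<lparr>carrier := E\<rparr> \<cong> C2_power r"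
    and "x \<in> {..<r} \<rightarrow> E" and "generate G (x ` {..<r}) = E"
    and "K \<lhd> G" and "card (rcosets\<^bsub>G\<^esub> K) = 2 ^ r" and "E \<subseteq> K"
    and "\<exists>A. signature_set (G\<lparr>carrier := K\<rparr>) E r x A"
  shows "G \<in> hadamard_groups"
proof -
  interpret group G by fact
  have subE: "subgroup E G" using assms(3) by (rule normal_imp_subgroup)
  obtain \<phi> where \<phi>: "\<phi> \<in> iso (G\<lparr>carrier := E\<rparr>) (C2_power r)"
    using assms(4) by (auto simp: is_iso_def)
  then have bij: "bij_betw \<phi> E (carrier (C2_power r))"
    and hom: "\<And>a b. a \<in> E \<Longrightarrow> b \<in> E \<Longrightarrow> \<phi> (a \<otimes>\<^bsub>G\<^esub> b) = \<phi> a \<otimes>\<^bsub>C2_power r\<^esub> \<phi> b"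
    by (auto simp: iso_def hom_def)
  have "a \<otimes>\<^bsub>G\<^esub> a = \<one>\<^bsub>G\<^esub>" if a: "a \<in> E" for a
  proof -
    have in_E: "a \<otimes>\<^bsub>G\<^esub> a \<in> E" "\<one>\<^bsub>G\<^esub> \<in> E"
      using subE a by (auto intro: subgroup.m_closed subgroup.one_closed)
    have "\<phi> b \<otimes>\<^bsub>C2_power r\<^esub> \<phi> b = \<one>\<^bsub>C2_power r\<^esub>" if "b \<in> E" for b
      using C2_power_facts(2) bij_betwE[OF bij] that by blast
    \<comment> \<open>The identity is written as a square, so that both sides map to the identity by
      exponent 2 in \<open>C2_power r\<close>; injectivity of \<open>\<phi>\<close> then
      applies.\<close>
    then have "\<phi> (a \<otimes>\<^bsub>G\<^esub> a) = \<phi> (\<one>\<^bsub>G\<^esub> \<otimes>\<^bsub>G\<^esub> \<one>\<^bsub>G\<^esub>)"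
      using hom a in_E(2) by metis
    then show ?thesis using in_E bij by (simp add: bij_betw_def inj_on_def)
  qed
  moreover have "card E = 2 ^ r"
    using bij_betw_same_card[OF bij] C2_power_facts(1) by simp
  ultimately interpret signature_subgroup G E r x K
    using assms subE
    by (intro signature_subgroup.intro elementary_abelian_subgroup.intro finite_group.intro
        signature_subgroup_axioms.intro elementary_abelian_subgroup_axioms.intro
        finite_group_axioms.intro)
  show ?thesis
    using signature_set_imp_hadamard assms by (auto simp: hadamard_groups_def)
qed

end
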